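(* Let $\mathrm{k}$ be an algebraically closed field of characteristic $p$. (1) Let $n\geq 2$ be an integer and assume that $p$ divides $n$. Then every near-pencil arrangement of $n+1$ lines in $\mathbb{P}^2_{\mathrm{k}}$ is homaloidal. (2) Let $n\geq 2$ be an integer and assume that $p$ divides $n(n-1)-1$. Then the curve $G_n=\mathbb{V}\big(x_0x_1(x_1^{n-1}+x_0^{n-2}x_2)\big)\subset\mathbb{P}^2_{\mathrm{k}}$ is homaloidal.
   Context: A near-pencil arrangement of $n+1$ lines in $\mathbb{P}^2_{\mathrm{k}}$ is the union of $n$ distinct lines through a given point $z_0$ together with one further line not passing through $z_0$. For a homogeneous polynomial $f\in \mathrm{k}[x_0,x_1,x_2]$, the polar map $\Phi_f:\mathbb{P}^2_{\mathrm{k}}\dashrightarrow\mathbb{P}^2_{\mathrm{k}}$ is the rational map defined by the partial derivatives $\left(\frac{\partial f}{\partial x_0}:\frac{\partial f}{\partial x_1}:\frac{\partial f}{\partial x_2}\right)$. The polynomial $f$ is called homaloidal if the linear system $\langle \frac{\partial f}{\partial x_0},\frac{\partial f}{\partial x_1},\frac{\partial f}{\partial x_2}\rangle$ has no fixed component (i.e. the three partial derivatives have no common factor of positive degree) and $\Phi_f$ is birational. A reduced projective plane curve $F=\mathbb{V}(f)\subset\mathbb{P}^2_{\mathrm{k}}$, with $f$ its reduced equation, is called homaloidal if $f$ is homaloidal. *)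

theory Defs
  imports
    "HOL-Computational_Algebra.Computational_Algebra"
    "HOL-Library.Poly_Mapping"
    "HOL-Library.Numeral_Type"
    "HOL-Analysis.Finite_Cartesian_Product"
begin

section \<open>The polynomial ring in the variables $x_0, x_1, x_2$\<close>

text \<open>
  A monomial is an exponent vector indexed by the three-element type \<^typ>\<open>3\<close>, whose
  elements are \<open>0\<close>, \<open>1\<close>, \<open>2\<close>; the ring operations are those of \<^type>\<open>poly_mapping\<close>.
\<close>

type_synonym 'a poly3 = "(3 \<Rightarrow>\<^sub>0 nat) \<Rightarrow>\<^sub>0 'a"

definition const3 :: "'a::comm_ring_1 \<Rightarrow> 'a poly3" where
  "const3 c = Poly_Mapping.single 0 c"

definition var3 :: "3 \<Rightarrow> 'a::comm_ring_1 poly3" where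
  "var3 i = Poly_Mapping.single (Poly_Mapping.single i 1) 1"

definition mon_degree :: "(3 \<Rightarrow>\<^sub>0 nat) \<Rightarrow> nat" where
  "mon_degree m = (\<Sum>i\<in>UNIV. Poly_Mapping.lookup m i)"

text \<open>The total degree; it is \<open>0\<close> for the zero polynomial.\<close>

definition degree3 :: "'a::comm_ring_1 poly3 \<Rightarrow> nat" where
  "degree3 f = Max (insert 0 (mon_degree ` Poly_Mapping.keys f))"

text \<open>Homogeneous polynomials of degree \<open>d\<close>; the zero polynomial is a form of every degree.\<close>

definition is_form :: "nat \<Rightarrow> 'a::comm_ring_1 poly3 \<Rightarrow> bool" where
  "is_form d f \<longleftrightarrow> (\<forall>m\<in>Poly_Mapping.keys f. mon_degree m = d)"

definition eval3 :: "'a::comm_ring_1 poly3 \<Rightarrow> 'a ^ 3 \<Rightarrow> 'a" where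
  "eval3 f v = (\<Sum>m\<in>Poly_Mapping.keys f.
     Poly_Mapping.lookup f m * (\<Prod>i\<in>UNIV. (v $ i) ^ Poly_Mapping.lookup m i))"

definition subst3 :: "'a::comm_ring_1 poly3 \<Rightarrow> (3 \<Rightarrow> 'a poly3) \<Rightarrow> 'a poly3" where
  "subst3 f g = (\<Sum>m\<in>Poly_Mapping.keys f.
     const3 (Poly_Mapping.lookup f m) * (\<Prod>i\<in>UNIV. g i ^ Poly_Mapping.lookup m i))"

text \<open>
  The formal partial derivative with respect to $x_i$. The subtraction of exponents is
  truncated, but where truncation occurs the coefficient is \<open>0\<close>.
\<close>

definition partial3 :: "3 \<Rightarrow> 'a::comm_ring_1 poly3 \<Rightarrow> 'a poly3" where
  "partial3 i f = (\<Sum>m\<in>Poly_Mapping.keys f.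
     Poly_Mapping.single (m - Poly_Mapping.single i 1)
       (of_nat (Poly_Mapping.lookup m i) * Poly_Mapping.lookup f m))"


section \<open>The projective plane\<close>

text \<open>
  A point of the projective plane is a one-dimensional subspace of \<^typ>\<open>'a ^ 3\<close>, so that
  subsets of the plane have type \<^typ>\<open>('a ^ 3) set set\<close>.
\<close>

definition proj_point :: "'a::field ^ 3 \<Rightarrow> ('a ^ 3) set" where
  "proj_point v = {c *s v | c. True}"

definition proj_plane :: "('a::field ^ 3) set set" where
  "proj_plane = {proj_point v | v. v \<noteq> 0}"

text \<open>The zero locus; meaningful for homogeneous \<open>f\<close> only.\<close>

definition zero_locus :: "'a::field poly3 \<Rightarrow> ('a ^ 3) set set" where
  "zero_locus f = {proj_point v | v. v \<noteq> 0 \<and> eval3 f v = 0}"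

definition proj_line :: "('a::field ^ 3) set set \<Rightarrow> bool" where
  "proj_line L \<longleftrightarrow> (\<exists>l. is_form 1 l \<and> l \<noteq> 0 \<and> L = zero_locus l)"

text \<open>Near-pencil arrangements of \<open>n + 1\<close> lines: \<open>n\<close> lines through \<open>z\<close> and one line missing \<open>z\<close>.\<close>

definition near_pencil :: "nat \<Rightarrow> ('a::field ^ 3) set set \<Rightarrow> bool" where
  "near_pencil n F \<longleftrightarrow> (\<exists>z\<in>proj_plane. \<exists>P M.
     finite P \<and> card P = n \<and> (\<forall>L\<in>P. proj_line L \<and> z \<in> L) \<and>
     proj_line M \<and> z \<notin> M \<and> F = \<Union>P \<union> M)"


section \<open>Rational self-maps of the projective plane\<close>

text \<open>
  A rational map $(g_0 : g_1 : g_2)$ is given by forms of the same degree, not all zero.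
  Two such triples define the same map iff they are proportional over the function field.
  The composite of two maps is represented by substitution whenever the substituted triple
  is not identically zero.
\<close>

definition rational_map :: "(3 \<Rightarrow> 'a::field poly3) \<Rightarrow> bool" where
  "rational_map g \<longleftrightarrow> (\<exists>d. \<forall>i. is_form d (g i)) \<and> (\<exists>i. g i \<noteq> 0)"

definition same_map :: "(3 \<Rightarrow> 'a::field poly3) \<Rightarrow> (3 \<Rightarrow> 'a poly3) \<Rightarrow> bool" where
  "same_map g h \<longleftrightarrow> (\<forall>i j. g i * h j = g j * h i)"

definition comp_map :: "(3 \<Rightarrow> 'a::field poly3) \<Rightarrow> (3 \<Rightarrow> 'a poly3) \<Rightarrow> 3 \<Rightarrow> 'a poly3" where
  "comp_map g h = (\<lambda>i. subst3 (g i) h)"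

text \<open>The identity map is represented by \<^const>\<open>var3\<close>, i.e. by $(x_0 : x_1 : x_2)$.\<close>

definition birational :: "(3 \<Rightarrow> 'a::field poly3) \<Rightarrow> bool" where
  "birational g \<longleftrightarrow> rational_map g \<and> (\<exists>h. rational_map h \<and>
     rational_map (comp_map g h) \<and> same_map (comp_map g h) var3 \<and>
     rational_map (comp_map h g) \<and> same_map (comp_map h g) var3)"


section \<open>Homaloidal polynomials and curves\<close>

definition polar_map :: "'a::field poly3 \<Rightarrow> 3 \<Rightarrow> 'a poly3" where
  "polar_map f = (\<lambda>i. partial3 i f)"

definition homaloidal :: "'a::field poly3 \<Rightarrow> bool" where
  "homaloidal f \<longleftrightarrow> (\<exists>d. is_form d f) \<and>
     \<not> (\<exists>q. degree3 q > 0 \<and> (\<forall>i. q dvd partial3 i f)) \<and>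
     birational (polar_map f)"

definition reduced_equation :: "'a::field poly3 \<Rightarrow> ('a ^ 3) set set \<Rightarrow> bool" where
  "reduced_equation f F \<longleftrightarrow> (\<exists>d>0. is_form d f) \<and> squarefree f \<and> F = zero_locus f"

text \<open>
  Over an algebraically closed field the reduced equation of a curve is unique up to a nonzero
  scalar, so the existential quantifier below does not depend on a choice.
\<close>

definition homaloidal_curve :: "('a::alg_closed_field ^ 3) set set \<Rightarrow> bool" where
  "homaloidal_curve F \<longleftrightarrow> (\<exists>f. reduced_equation f F \<and> homaloidal f)"

end

(*
Write a near-pencil as the zero locus of m g, with g a product of n linear forms vanishing at z
and m(z) = 1. The gradient of g is orthogonal to z and, by Euler's formula and p | n, to x, so it
equals h times the cross product x \<times> z; hence y = \<nabla>(m g)(x) = g(x) \<nabla>m + m(x) h(x) x \<times> z. Modulo z the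
point x is recovered as \<nabla>m \<times> y, and the component along z from y . z = g(x), rationally in y.
The partial derivatives have no common factor q: by Euler's formula q would divide m g, since its
degree n + 1 is 1 modulo p, and no factor of a product of distinct lines divides all partials.

For G_n write E = x_1^(n-1) + (n - 1) x_0^(n-2) x_2. As n (n - 1) = 1 in the field, the polar map is
(x_1 E : n x_0 E : x_0^(n-1) x_1), which is inverted by reading off x_1 : n x_0 and then solving
for x_2, in which E is linear.

The equations are squarefree because a square factor of f would be a common factor of its partials.
*)

theory Submission
  imports Defs
begin


section \<open>The polynomial ring\<close>

lemma UNIV_three: "(UNIV :: 3 set) = {0, 1, 2}"
proof -
  have "i \<in> {0, 1, 2}" for i :: 3
  proof (cases i)
    case (of_int z)
    then have "z = 0 \<or> z = 1 \<or> z = 2" by auto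
    with of_int show ?thesis by auto
  qed
  then show ?thesis by blast
qed

lemma three_cases: "P (0::3) \<Longrightarrow> P 1 \<Longrightarrow> P 2 \<Longrightarrow> P i"
  using UNIV_three by (metis UNIV_I insert_iff singletonD)

lemma sum_three: "(\<Sum>i\<in>UNIV. f i) = f 0 + f 1 + f (2::3)"
  for f :: "3 \<Rightarrow> 'b::comm_monoid_add"
  unfolding UNIV_three by (simp add: add.assoc)

lemma prod_three: "(\<Prod>i\<in>UNIV. f i) = f 0 * f 1 * f (2::3)"
  for f :: "3 \<Rightarrow> 'b::comm_monoid_mult"
  unfolding UNIV_three by (simp add: mult.assoc)

section \<open>Monomials and induction principles\<close>

definition monom_value :: "(3 \<Rightarrow> 'b::comm_monoid_mult) \<Rightarrow> (3 \<Rightarrow>\<^sub>0 nat) \<Rightarrow> 'b" where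
  "monom_value g m = (\<Prod>i\<in>UNIV. g i ^ Poly_Mapping.lookup m i)"

lemma monom_value_0 [simp]: "monom_value g 0 = 1"
  by (simp add: monom_value_def)

lemma monom_value_add: "monom_value g (m + n) = monom_value g m * monom_value g n"
  by (simp add: monom_value_def lookup_add power_add prod.distrib)

lemma monom_value_single [simp]: "monom_value g (Poly_Mapping.single i k) = g i ^ k"
proof -
  have "monom_value g (Poly_Mapping.single i k) = (\<Prod>j\<in>UNIV. if j = i then g i ^ k else 1)"
    unfolding monom_value_def by (rule prod.cong) (auto simp: lookup_single when_def)
  then show ?thesis by simp
qed

lemma mon_degree_add: "mon_degree (m + n) = mon_degree m + mon_degree n"
  by (simp add: mon_degree_def lookup_add sum.distrib)

lemma mon_degree_0 [simp]: "mon_degree 0 = 0"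
  by (simp add: mon_degree_def)

lemma mon_degree_single [simp]: "mon_degree (Poly_Mapping.single i k) = k"
  by (simp add: mon_degree_def lookup_single when_def)

lemma mon_degree_eq_0_iff: "mon_degree m = 0 \<longleftrightarrow> m = 0"
  by (auto simp: mon_degree_def intro: poly_mapping_eqI)

lemma poly_mapping_eq_sum_single:
  "f = (\<Sum>m\<in>Poly_Mapping.keys f. Poly_Mapping.single m (Poly_Mapping.lookup f m))"
  by (rule poly_mapping_eqI) (auto simp: lookup_sum lookup_single when_def in_keys_iff)

text \<open>Applies to polynomials and to exponent vectors alike, both being finitely supported
  functions.\<close>

lemma poly_mapping_single_induct [case_names zero single add]:
  fixes f :: "'b \<Rightarrow>\<^sub>0 'c::comm_monoid_add"
  assumes "P 0" and "\<And>m c. P (Poly_Mapping.single m c)" and "\<And>f g. P f \<Longrightarrow> P g \<Longrightarrow> P (f + g)"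
  shows "P f"
proof -
  have "P (\<Sum>m\<in>A. Poly_Mapping.single m (Poly_Mapping.lookup f m))" if "finite A" for A
    using that by induction (auto intro: assms)
  from this[OF finite_keys] show ?thesis
    by (subst poly_mapping_eq_sum_single)
qed

lemma const3_0 [simp]: "const3 0 = 0"
  and const3_1 [simp]: "const3 1 = 1"
  by (simp_all add: const3_def)

lemma const3_add: "const3 (a + b) = const3 a + const3 b"
  and const3_minus: "const3 (- a) = - const3 a"
  and const3_mult: "const3 (a * b) = const3 a * const3 b"
  by (simp_all add: const3_def single_add single_uminus mult_single)

lemma const3_of_nat: "const3 (of_nat n) = of_nat n"
  by (simp add: const3_def)

lemma const3_power: "const3 (a ^ n) = const3 a ^ n"
  by (induction n) (simp_all add: const3_mult)

lemma const3_prod: "const3 (\<Prod>i\<in>A. h i) = (\<Prod>i\<in>A. const3 (h i))"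
  by (induction A rule: infinite_finite_induct) (simp_all add: const3_mult)

lemma const3_sum: "const3 (\<Sum>i\<in>A. h i) = (\<Sum>i\<in>A. const3 (h i))"
  by (induction A rule: infinite_finite_induct) (simp_all add: const3_add)

lemma const3_inject [simp]: "const3 a = const3 b \<longleftrightarrow> a = b"
  by (metis const3_def lookup_single_eq)

lemma const3_eq_0_iff [simp]: "const3 a = 0 \<longleftrightarrow> a = 0"
  using const3_inject[of a 0] by simp

lemma var3_neq_0 [simp]: "(var3 i :: 'a::comm_ring_1 poly3) \<noteq> 0"
  by (metis var3_def lookup_single_eq lookup_zero zero_neq_one)

lemma single_eq_const3_mult: "Poly_Mapping.single m c = const3 c * monom_value var3 m"
  for c :: "'a::comm_ring_1"
proof -
  have "monom_value var3 m = Poly_Mapping.single m (1::'a)"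
  proof (induction m rule: poly_mapping_single_induct)
    case (single i k)
    have "var3 i ^ k = Poly_Mapping.single (Poly_Mapping.single i k) (1::'a)"
      by (induction k) (simp_all add: var3_def mult_single single_add [symmetric])
    then show ?case by simp
  next
    case (add m n)
    then show ?case by (simp add: monom_value_add mult_single)
  qed simp
  then show ?thesis by (simp add: const3_def mult_single)
qed

text \<open>Every monomial is a constant times a product of variables, so identities between ring
  homomorphisms reduce to constants and variables.\<close>

lemma poly3_induct [case_names const var add mult]:
  fixes f :: "'a::comm_ring_1 poly3"
  assumes const: "\<And>c. P (const3 c)" and var: "\<And>i. P (var3 i)"
    and add: "\<And>f g. P f \<Longrightarrow> P g \<Longrightarrow> P (f + g)" and mult: "\<And>f g. P f \<Longrightarrow> P g \<Longrightarrow> P (f * g)"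
  shows "P f"
proof -
  have one: "P 1" using const[of 1] by simp
  have pow: "P (g ^ n)" if "P g" for g n
    by (induction n) (auto intro: one mult that)
  have "P (monom_value var3 m)" for m
    unfolding monom_value_def prod_three by (intro mult pow var)
  then show ?thesis
    by (induction f rule: poly_mapping_single_induct)
      (use const[of 0] in \<open>auto simp: single_eq_const3_mult intro: const add mult\<close>)
qed

section \<open>Substitution as a ring homomorphism\<close>

lemma subst3_superset:
  assumes "finite S" "Poly_Mapping.keys f \<subseteq> S"
  shows "subst3 f g = (\<Sum>m\<in>S. const3 (Poly_Mapping.lookup f m) * monom_value g m)"
  unfolding subst3_def monom_value_def [symmetric]
  by (rule sum.mono_neutral_left) (use assms in \<open>auto simp: in_keys_iff\<close>)

lemma subst3_add: "subst3 (f + g) h = subst3 f h + subst3 g h"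
proof -
  let ?S = "Poly_Mapping.keys f \<union> Poly_Mapping.keys g"
  have "Poly_Mapping.keys (f + g) \<subseteq> ?S" by (rule keys_add)
  then show ?thesis
    by (simp add: subst3_superset[of ?S] lookup_add const3_add algebra_simps sum.distrib)
qed

lemma subst3_single: "subst3 (Poly_Mapping.single m c) g = const3 c * monom_value g m"
  by (subst subst3_superset[of "{m}"]) auto

lemma subst3_0 [simp]: "subst3 0 g = 0"
  by (simp add: subst3_def)

lemma subst3_const [simp]: "subst3 (const3 c) g = const3 c"
  using subst3_single[of 0 c g] by (simp add: const3_def)

lemma subst3_1 [simp]: "subst3 1 g = 1"
  using subst3_const[of 1 g] by simp

lemma subst3_var [simp]: "subst3 (var3 i) g = g i"
  by (simp add: var3_def subst3_single)

text \<open>Both sides are additive in \<open>f\<close> and in \<open>g\<close>, which reduces the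
  claim to two monomials.\<close>

lemma subst3_mult: "subst3 (f * g) h = subst3 f h * subst3 g h"
proof (induction f rule: poly_mapping_single_induct)
  case (single m c)
  show ?case
  proof (induction g rule: poly_mapping_single_induct)
    case (single n d)
    show ?case
      by (simp add: mult_single subst3_single const3_mult monom_value_add algebra_simps)
  qed (simp_all add: subst3_add distrib_left)
qed (simp_all add: subst3_add distrib_right)

lemma subst3_minus: "subst3 (- f) h = - subst3 f h"
  using subst3_add[of f "- f" h] by (simp add: add_eq_0_iff)

lemma subst3_diff: "subst3 (f - g) h = subst3 f h - subst3 g h"
  using subst3_add[of f "- g" h] by (simp add: subst3_minus)

lemma subst3_power: "subst3 (f ^ n) h = subst3 f h ^ n"
  by (induction n) (simp_all add: subst3_mult)

lemma subst3_prod: "subst3 (\<Prod>i\<in>A. f i) h = (\<Prod>i\<in>A. subst3 (f i) h)"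
  by (induction A rule: infinite_finite_induct) (simp_all add: subst3_mult)

lemma subst3_of_nat [simp]: "subst3 (of_nat n) h = of_nat n"
  by (metis const3_of_nat subst3_const)

lemmas subst3_ring = subst3_add subst3_minus subst3_diff subst3_mult subst3_power

lemma subst3_subst3: "subst3 (subst3 f g) h = subst3 f (\<lambda>i. subst3 (g i) h)"
  by (induction f rule: poly3_induct) (simp_all add: subst3_ring)

lemma subst3_var3 [simp]: "subst3 f var3 = f"
  by (induction f rule: poly3_induct) (simp_all add: subst3_ring)

text \<open>Congruence modulo \<open>l\<close> is respected by sums and products, hence by every
  polynomial expression.\<close>

lemma dvd_subst3_diff:
  assumes "\<And>i. l dvd g i - h i"
  shows "l dvd subst3 f g - subst3 f h"
proof (induction f rule: poly3_induct)
  case (add p q)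
  then show ?case
    using dvd_add[OF add] by (simp add: subst3_add algebra_simps)
next
  case (mult p q)
  have "subst3 (p * q) g - subst3 (p * q) h
      = subst3 p g * (subst3 q g - subst3 q h) + (subst3 p g - subst3 p h) * subst3 q h"
    by (simp add: subst3_mult algebra_simps)
  then show ?case using mult by simp
qed (simp_all add: assms)

text \<open>Evaluation is substitution of constants, so \<open>eval3\<close> inherits
  multiplicativity from \<open>subst3\<close>.\<close>

lemma const3_eval3: "const3 (eval3 f v) = subst3 f (\<lambda>i. const3 (v $ i))"
  by (simp add: eval3_def subst3_def const3_sum const3_mult const3_prod const3_power)

lemma eval3_mult: "eval3 (f * g) v = eval3 f v * eval3 g v"
  by (rule const3_inject [THEN iffD1]) (simp add: const3_mult const3_eval3 subst3_mult)

lemma eval3_1: "eval3 1 v = 1"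
  by (rule const3_inject [THEN iffD1]) (simp add: const3_eval3)

lemma eval3_prod: "eval3 (\<Prod>i\<in>A. f i) v = (\<Prod>i\<in>A. eval3 (f i) v)"
  by (induction A rule: infinite_finite_induct) (simp_all add: eval3_mult eval3_1)

section \<open>Formal partial derivatives\<close>

lemma partial3_superset:
  assumes "finite S" "Poly_Mapping.keys f \<subseteq> S"
  shows "partial3 i f = (\<Sum>m\<in>S. Poly_Mapping.single (m - Poly_Mapping.single i 1)
       (of_nat (Poly_Mapping.lookup m i) * Poly_Mapping.lookup f m))"
  unfolding partial3_def
  by (rule sum.mono_neutral_left) (use assms in \<open>auto simp: in_keys_iff\<close>)

lemma partial3_0 [simp]: "partial3 i 0 = 0"
  by (simp add: partial3_def)

lemma partial3_add: "partial3 i (f + g) = partial3 i f + partial3 i g"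
proof -
  let ?S = "Poly_Mapping.keys f \<union> Poly_Mapping.keys g"
  have "Poly_Mapping.keys (f + g) \<subseteq> ?S" by (rule keys_add)
  then show ?thesis
    by (simp add: partial3_superset[of ?S] lookup_add algebra_simps single_add sum.distrib)
qed

lemma partial3_single: "partial3 i (Poly_Mapping.single m c) =
    Poly_Mapping.single (m - Poly_Mapping.single i 1) (of_nat (Poly_Mapping.lookup m i) * c)"
  by (subst partial3_superset[of "{m}"]) auto

lemma partial3_const [simp]: "partial3 i (const3 c) = 0"
  by (simp add: const3_def partial3_single)

lemma partial3_1 [simp]: "partial3 i 1 = 0"
  using partial3_const[of i 1] by simp

lemma partial3_var: "partial3 i (var3 j) = (if i = j then 1 else 0)"
  by (simp add: var3_def partial3_single lookup_single when_def)

lemma single_exponent_diff_add: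
  assumes "Poly_Mapping.lookup m i \<noteq> 0"
  shows "m - Poly_Mapping.single i 1 + n = m + n - Poly_Mapping.single i (1::nat)"
  by (rule poly_mapping_eqI)
    (use assms in \<open>auto simp: lookup_add lookup_minus lookup_single when_def\<close>)

lemma partial3_mult: "partial3 i (f * g) = partial3 i f * g + f * partial3 i g"
proof (induction f rule: poly_mapping_single_induct)
  case (single m c)
  show ?case
  proof (induction g rule: poly_mapping_single_induct)
    case (single n d)
    let ?e = "Poly_Mapping.single i (1::nat)"
    \<comment> \<open>If the exponent of \<open>x_i\<close> in \<open>m\<close> is 0, truncation may
      spoil the exponent vectors, but both coefficients vanish.\<close>
    have 1: "partial3 i (Poly_Mapping.single m c) * Poly_Mapping.single n d =
        Poly_Mapping.single (m + n - ?e) (of_nat (Poly_Mapping.lookup m i) * c * d)"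
      by (cases "Poly_Mapping.lookup m i = 0")
        (simp_all add: partial3_single mult_single single_exponent_diff_add del: One_nat_def)
    have 2: "Poly_Mapping.single m c * partial3 i (Poly_Mapping.single n d) =
        Poly_Mapping.single (m + n - ?e) (of_nat (Poly_Mapping.lookup n i) * c * d)"
      using single_exponent_diff_add[of n i m]
      by (cases "Poly_Mapping.lookup n i = 0")
        (simp_all add: partial3_single mult_single algebra_simps del: One_nat_def)
    show ?case unfolding 1 2
      by (simp add: partial3_single mult_single lookup_add single_add [symmetric] algebra_simps)
  qed (simp_all add: partial3_add distrib_left)
qed (simp_all add: partial3_add distrib_right)

lemma partial3_power: "partial3 i (f ^ n) = of_nat n * f ^ (n - 1) * partial3 i f"
proof (induction n)
  case (Suc n)
  then show ?case by (cases n) (simp_all add: partial3_mult algebra_simps)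
qed simp


section \<open>Grading\<close>

lemma is_form_0 [simp]: "is_form d 0"
  by (simp add: is_form_def)

lemma is_form_add: "is_form d f \<Longrightarrow> is_form d g \<Longrightarrow> is_form d (f + g)"
  using keys_add[of f g] by (auto simp: is_form_def)

lemma is_form_minus: "is_form d f \<Longrightarrow> is_form d (- f)"
  by (auto simp: is_form_def in_keys_iff)

lemma is_form_diff: "is_form d f \<Longrightarrow> is_form d g \<Longrightarrow> is_form d (f - g)"
  using is_form_add[OF _ is_form_minus, of d f g] by simp

lemma is_form_sum: "(\<And>i. i \<in> A \<Longrightarrow> is_form d (f i)) \<Longrightarrow> is_form d (\<Sum>i\<in>A. f i)"
  by (induction A rule: infinite_finite_induct) (auto intro: is_form_add)

lemma is_form_mult: "is_form d f \<Longrightarrow> is_form e g \<Longrightarrow> is_form (d + e) (f * g)"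
  using keys_mult[of f g] by (fastforce simp: is_form_def mon_degree_add)

lemma is_form_const [simp]: "is_form 0 (const3 c)"
  by (auto simp: is_form_def const3_def)

lemma is_form_1 [simp]: "is_form 0 1"
  using is_form_const[of 1] by simp

lemma is_form_const_mult: "is_form d f \<Longrightarrow> is_form d (const3 c * f)"
  using is_form_mult[OF is_form_const] by fastforce

lemma is_form_var [simp]: "is_form (Suc 0) (var3 i)"
  by (auto simp: is_form_def var3_def)

lemma is_form_power: "is_form d f \<Longrightarrow> is_form (n * d) (f ^ n)"
  by (induction n) (auto intro: is_form_mult)

lemma is_form_prod:
  "finite A \<Longrightarrow> (\<And>i. i \<in> A \<Longrightarrow> is_form d (f i)) \<Longrightarrow> is_form (card A * d) (\<Prod>i\<in>A. f i)"
  by (induction A rule: finite_induct) (auto intro: is_form_mult)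

lemma is_form_partial: "is_form (Suc d) f \<Longrightarrow> is_form d (partial3 i f)"
  unfolding partial3_def
proof (rule is_form_sum)
  fix m assume f: "is_form (Suc d) f" and m: "m \<in> Poly_Mapping.keys f"
  show "is_form d (Poly_Mapping.single (m - Poly_Mapping.single i 1)
       (of_nat (Poly_Mapping.lookup m i) * Poly_Mapping.lookup f m))"
  proof (cases "Poly_Mapping.lookup m i = 0")
    case False
    then have "m - Poly_Mapping.single i 1 + Poly_Mapping.single i 1 = m"
      by (intro poly_mapping_eqI) (auto simp: lookup_add lookup_minus lookup_single when_def)
    then have "mon_degree (m - Poly_Mapping.single i 1) + 1 = mon_degree m"
      by (metis mon_degree_add mon_degree_single)
    then have "mon_degree (m - Poly_Mapping.single i 1) = d"
      using f m by (simp add: is_form_def)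
    then show ?thesis by (auto simp: is_form_def)
  qed simp
qed

lemma is_form_monom_value:
  assumes "\<And>i. is_form e (g i)"
  shows "is_form (mon_degree m * e) (monom_value g m)"
proof -
  have "is_form (Poly_Mapping.lookup m 0 * e + Poly_Mapping.lookup m 1 * e
      + Poly_Mapping.lookup m 2 * e) (monom_value g m)"
    unfolding monom_value_def prod_three by (intro is_form_mult is_form_power assms)
  then show ?thesis by (simp add: mon_degree_def sum_three algebra_simps)
qed

lemma is_form_subst3:
  assumes "is_form d f" "\<And>i. is_form e (g i)"
  shows "is_form (d * e) (subst3 f g)"
  unfolding subst3_def monom_value_def [symmetric]
  by (intro is_form_sum is_form_const_mult)
    (use assms(1) is_form_monom_value[OF assms(2)] in \<open>fastforce simp: is_form_def\<close>)

text \<open>The factor \<open>s\<close> may be any polynomial, not just a scalar: this extracts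
  common factors when rational maps are composed.\<close>

lemma subst3_scale:
  assumes "is_form d f"
  shows "subst3 f (\<lambda>i. s * w i) = s ^ d * subst3 f w"
  unfolding subst3_def monom_value_def [symmetric] sum_distrib_left
proof (rule sum.cong)
  fix m assume "m \<in> Poly_Mapping.keys f"
  then have "s ^ mon_degree m = s ^ d" using assms by (simp add: is_form_def)
  moreover have "monom_value (\<lambda>i. s * w i) m = s ^ mon_degree m * monom_value w m"
    by (simp add: monom_value_def mon_degree_def power_mult_distrib prod.distrib power_sum)
  ultimately show "const3 (Poly_Mapping.lookup f m) * monom_value (\<lambda>i. s * w i) m
      = s ^ d * (const3 (Poly_Mapping.lookup f m) * monom_value w m)"
    by (simp add: algebra_simps)
qed simp

text \<open>Multiplying the derivative of a monomial by \<open>x_i\<close> restores the monomial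
  with its exponent as coefficient; the exponents add up to \<open>d\<close>.\<close>

lemma euler_partial3:
  assumes "is_form d f"
  shows "(\<Sum>i\<in>UNIV. var3 i * partial3 i f) = of_nat d * f"
proof -
  have *: "var3 i * Poly_Mapping.single (m - Poly_Mapping.single i 1) (of_nat (Poly_Mapping.lookup m i) * c)
      = Poly_Mapping.single m (of_nat (Poly_Mapping.lookup m i) * c)" for i m and c :: 'a
  proof (cases "Poly_Mapping.lookup m i = 0")
    case False
    then have "Poly_Mapping.single i 1 + (m - Poly_Mapping.single i 1) = m"
      by (intro poly_mapping_eqI) (auto simp: lookup_add lookup_minus lookup_single when_def)
    then show ?thesis by (simp add: var3_def mult_single)
  qed simp
  have "(\<Sum>i\<in>UNIV. var3 i * partial3 i f) = (\<Sum>m\<in>Poly_Mapping.keys f. \<Sum>i\<in>UNIV.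
      Poly_Mapping.single m (of_nat (Poly_Mapping.lookup m i) * Poly_Mapping.lookup f m))"
    unfolding partial3_def sum_distrib_left * by (rule sum.swap)
  also have "\<dots> = (\<Sum>m\<in>Poly_Mapping.keys f. of_nat d * Poly_Mapping.single m (Poly_Mapping.lookup f m))"
  proof (rule sum.cong)
    fix m assume "m \<in> Poly_Mapping.keys f"
    then have "d = mon_degree m" using assms by (simp add: is_form_def)
    then show "(\<Sum>i\<in>UNIV. Poly_Mapping.single m
          (of_nat (Poly_Mapping.lookup m i) * Poly_Mapping.lookup f m))
        = of_nat d * Poly_Mapping.single m (Poly_Mapping.lookup f m)"
      by (simp add: mon_degree_def sum_three single_add algebra_simps mult_single
          flip: single_of_nat)
  qed simp
  also have "\<dots> = of_nat d * f"
    by (simp flip: sum_distrib_left poly_mapping_eq_sum_single)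
  finally show ?thesis .
qed

text \<open>The image of \<open>f\<close> under $x_i \mapsto x_i T$; the coefficients are the homogeneous components.\<close>

definition graded :: "'a::comm_ring_1 poly3 \<Rightarrow> 'a poly3 poly" where
  "graded f = (\<Sum>m\<in>Poly_Mapping.keys f.
     Polynomial.monom (Poly_Mapping.single m (Poly_Mapping.lookup f m)) (mon_degree m))"

lemma graded_superset:
  assumes "finite S" "Poly_Mapping.keys f \<subseteq> S"
  shows "graded f = (\<Sum>m\<in>S.
     Polynomial.monom (Poly_Mapping.single m (Poly_Mapping.lookup f m)) (mon_degree m))"
  unfolding graded_def
  by (rule sum.mono_neutral_left) (use assms in \<open>auto simp: in_keys_iff\<close>)

lemma graded_single: "graded (Poly_Mapping.single m c) = Polynomial.monom (Poly_Mapping.single m c) (mon_degree m)"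
  by (subst graded_superset[of "{m}"]) auto

lemma graded_0 [simp]: "graded 0 = 0"
  by (simp add: graded_def)

lemma graded_1 [simp]: "graded 1 = 1"
  using graded_single[of 0 1] by (simp add: monom_eq_1)

lemma graded_add: "graded (f + g) = graded f + graded g"
proof -
  let ?S = "Poly_Mapping.keys f \<union> Poly_Mapping.keys g"
  have "Poly_Mapping.keys (f + g) \<subseteq> ?S" by (rule keys_add)
  then show ?thesis
    by (simp add: graded_superset[of ?S] lookup_add single_add add_monom [symmetric] sum.distrib)
qed

lemma graded_mult: "graded (f * g) = graded f * graded g"
proof (induction f rule: poly_mapping_single_induct)
  case (single m c)
  show ?case
  proof (induction g rule: poly_mapping_single_induct)
    case (single n d)
    show ?case by (simp add: mult_single graded_single mult_monom mon_degree_add)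
  qed (simp_all add: graded_add distrib_left)
qed (simp_all add: graded_add distrib_right)

lemma lookup_coeff_graded:
  "Poly_Mapping.lookup (coeff (graded f) d) m = (if mon_degree m = d then Poly_Mapping.lookup f m else 0)"
  by (induction f rule: poly_mapping_single_induct)
    (auto simp: graded_single graded_add lookup_add lookup_single when_def)

lemma is_form_iff_coeff_graded: "is_form d f \<longleftrightarrow> (\<forall>k. k \<noteq> d \<longrightarrow> coeff (graded f) k = 0)"
proof (intro iffI allI impI)
  fix k assume "is_form d f" "k \<noteq> d"
  then show "coeff (graded f) k = 0"
    by (intro poly_mapping_eqI) (auto simp: lookup_coeff_graded is_form_def in_keys_iff)
next
  assume *: "\<forall>k. k \<noteq> d \<longrightarrow> coeff (graded f) k = 0"
  show "is_form d f"
    unfolding is_form_def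
  proof (intro ballI, rule ccontr)
    fix m assume "m \<in> Poly_Mapping.keys f" "mon_degree m \<noteq> d"
    then show False
      using * lookup_coeff_graded[of f "mon_degree m" m] by (simp add: in_keys_iff)
  qed
qed

lemma graded_form:
  assumes "is_form d f"
  shows "graded f = Polynomial.monom f d"
proof (rule poly_eqI)
  fix k
  show "coeff (graded f) k = coeff (Polynomial.monom f d) k"
    using assms by (intro poly_mapping_eqI) (auto simp: lookup_coeff_graded is_form_def in_keys_iff)
qed

text \<open>As \<open>graded c\<close> is the single term \<open>c T^d\<close>, the coefficient of
  \<open>T^(d + k)\<close> in \<open>graded (c * h)\<close> is \<open>c\<close> times the component
  of \<open>h\<close> of degree \<open>k\<close>.\<close>

lemma is_form_cofactor:
  fixes c h :: "'a::idom poly3"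
  assumes "is_form d c" "c \<noteq> 0" "is_form (d + e) (c * h)"
  shows "is_form e h"
  unfolding is_form_iff_coeff_graded
proof (intro allI impI)
  fix k assume "k \<noteq> e"
  then have "coeff (graded (c * h)) (d + k) = 0"
    using assms(3) by (simp add: is_form_iff_coeff_graded)
  then have "c * coeff (graded h) k = 0"
    by (simp add: graded_mult graded_form[OF assms(1)] coeff_monom_mult)
  then show "coeff (graded h) k = 0" using assms(2) by simp
qed

lemma degree3_eq_0_iff: "degree3 f = 0 \<longleftrightarrow> is_form 0 f"
proof -
  have "degree3 f \<le> 0 \<longleftrightarrow> (\<forall>d \<in> insert 0 (mon_degree ` Poly_Mapping.keys f). d \<le> 0)"
    unfolding degree3_def by (subst Max_le_iff) auto
  then show ?thesis by (simp add: is_form_def)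
qed

lemma is_form_0_const:
  assumes "is_form 0 f"
  shows "\<exists>c. f = const3 c"
proof
  show "f = const3 (Poly_Mapping.lookup f 0)"
    using assms by (intro poly_mapping_eqI)
      (auto simp: const3_def lookup_single when_def is_form_def in_keys_iff mon_degree_eq_0_iff)
qed

text \<open>\<open>graded\<close> carries a unit to a unit of a univariate polynomial ring over a
  domain, which has degree 0.\<close>

lemma degree3_unit:
  fixes f :: "'a::idom poly3"
  assumes "f dvd 1"
  shows "degree3 f = 0"
proof -
  from assms obtain g where "1 = f * g" by (elim dvdE)
  then have "graded f * graded g = 1" by (metis graded_mult graded_1)
  then have "degree (graded f) = 0"
    by (metis add_is_0 degree_1 degree_mult_eq mult_zero_left mult_zero_right zero_neq_one)
  then show ?thesis
    by (auto simp: degree3_eq_0_iff is_form_iff_coeff_graded coeff_eq_0)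
qed

section \<open>Linear forms\<close>

definition lin3 :: "(3 \<Rightarrow> 'a::comm_ring_1) \<Rightarrow> 'a poly3" where
  "lin3 a = (\<Sum>i\<in>UNIV. const3 (a i) * var3 i)"

lemma is_form_lin3 [simp]: "is_form (Suc 0) (lin3 a)"
  unfolding lin3_def by (intro is_form_sum is_form_const_mult is_form_var)

lemma subst3_lin3: "subst3 (lin3 a) w = (\<Sum>i\<in>UNIV. const3 (a i) * w i)"
  by (simp add: lin3_def sum_three subst3_ring)

lemma eval3_lin3: "eval3 (lin3 a) v = (\<Sum>i\<in>UNIV. a i * (v $ i))"
  by (rule const3_inject [THEN iffD1])
    (simp add: const3_eval3 subst3_lin3 const3_sum const3_mult)

lemma partial3_lin3 [simp]: "partial3 i (lin3 a) = const3 (a i)"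
  by (induction i rule: three_cases)
    (simp_all add: lin3_def sum_three partial3_add partial3_mult partial3_var)

lemma lin3_eq_0_iff: "lin3 a = 0 \<longleftrightarrow> (\<forall>i. a i = 0)"
proof
  assume "lin3 a = 0"
  then have "partial3 i (lin3 a) = 0" for i by simp
  then show "\<forall>i. a i = 0" by simp
qed (simp add: lin3_def)

text \<open>The partial derivatives have degree 0 and are constants; Euler's formula rebuilds
  \<open>l\<close> from them.\<close>

lemma is_form_1_imp_lin3:
  assumes "is_form 1 l"
  shows "\<exists>a. l = lin3 a"
proof -
  have "\<exists>c. partial3 i l = const3 c" for i
    by (intro is_form_0_const is_form_partial) (use assms in simp)
  then obtain a where "\<And>i. partial3 i l = const3 (a i)" by metis
  then have "l = lin3 a"
    using euler_partial3[OF assms] by (simp add: lin3_def mult.commute)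
  then show ?thesis by blast
qed

text \<open>Modulo a linear form one variable can be eliminated, so the multiples of the form are
  the kernel of the ring endomorphism given by \<open>S\<close>.\<close>

lemma lin3_dvd_iff:
  fixes a :: "3 \<Rightarrow> 'a::field"
  assumes "lin3 a \<noteq> 0"
  obtains S where "\<And>f. lin3 a dvd f \<longleftrightarrow> subst3 f S = 0"
proof -
  obtain j where j: "a j \<noteq> 0" using assms by (auto simp: lin3_eq_0_iff)
  \<comment> \<open>\<open>S\<close> solves \<open>lin3 a = 0\<close> for \<open>x_j\<close> and
    fixes the other variables; each \<open>S i\<close> is congruent to \<open>x_i\<close> modulo
    \<open>lin3 a\<close>.\<close>
  define S where "S = (\<lambda>i. var3 i - (if i = j then const3 (1 / a j) * lin3 a else 0))"
  have "const3 (a i) * S i = const3 (a i) * var3 i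
      - (if i = j then const3 (a j) * (const3 (1 / a j) * lin3 a) else 0)" for i
    by (simp add: S_def right_diff_distrib)
  then have "subst3 (lin3 a) S = lin3 a
      - (\<Sum>i\<in>UNIV. if i = j then const3 (a j) * (const3 (1 / a j) * lin3 a) else 0)"
    by (simp add: subst3_lin3 sum_subtractf flip: lin3_def)
  also have "\<dots> = 0"
    using j by (simp flip: const3_mult mult.assoc)
  finally have S0: "subst3 (lin3 a) S = 0" .
  have "lin3 a dvd f \<longleftrightarrow> subst3 f S = 0" for f
  proof
    assume "subst3 f S = 0"
    moreover have "lin3 a dvd subst3 f var3 - subst3 f S"
      by (rule dvd_subst3_diff) (simp add: S_def)
    ultimately show "lin3 a dvd f" by simp
  qed (auto simp: S0 subst3_mult elim!: dvdE)
  then show ?thesis by (rule that)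
qed

text \<open>The kernel of a ring homomorphism into a domain is a prime ideal.\<close>

lemma prime_elem_lin3:
  fixes a :: "3 \<Rightarrow> 'a::field"
  assumes "lin3 a \<noteq> 0"
  shows "prime_elem (lin3 a)"
proof -
  obtain S where S: "\<And>f. lin3 a dvd f \<longleftrightarrow> subst3 f S = 0"
    using lin3_dvd_iff[OF assms] by blast
  show ?thesis
    unfolding prime_elem_def using assms by (auto simp: S subst3_mult)
qed

text \<open>The cofactor has degree 0, so it is a constant; differentiation compares the
  coefficients.\<close>

lemma lin3_dvd_lin3:
  fixes a b :: "3 \<Rightarrow> 'a::field"
  assumes "lin3 a dvd lin3 b" "lin3 a \<noteq> 0"
  obtains c where "\<And>i. b i = c * a i"
proof -
  obtain k where k: "lin3 b = lin3 a * k" using assms(1) by (elim dvdE)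
  have "is_form 0 k"
    by (rule is_form_cofactor[of "Suc 0" "lin3 a"]) (use assms(2) k in \<open>auto simp flip: k\<close>)
  then obtain c where "k = const3 c" using is_form_0_const by blast
  then have "const3 (b i) = const3 (c * a i)" for i
    using arg_cong[OF k, of "partial3 i"] by (simp add: partial3_mult const3_mult mult.commute)
  then show ?thesis using that by auto
qed

text \<open>In \<open>p * s = q * r\<close> the prime \<open>p\<close> must divide \<open>r\<close>,
  and then cancels.\<close>

lemma dvd_cancel_prime_elem:
  fixes p q s :: "'b::idom"
  assumes "prime_elem p" "q dvd p * s" "\<not> p dvd q"
  shows "q dvd s"
proof -
  obtain r where r: "p * s = q * r" using assms(2) by (elim dvdE)
  then have "p dvd r" using assms(1,3) by (metis dvd_triv_left prime_elem_dvd_multD)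
  then obtain r' where "r = p * r'" by (elim dvdE)
  with r have "p * s = p * (q * r')" by (simp add: algebra_simps)
  then have "s = q * r'" using assms(1) by (simp add: prime_elem_def)
  then show ?thesis by simp
qed

text \<open>The primes are cancelled one at a time until the empty product 1 is left.\<close>

lemma dvd_prod_prime_elem:
  fixes q :: "'b::idom"
  assumes "finite I" "\<And>i. i \<in> I \<Longrightarrow> prime_elem (p i)" "q dvd (\<Prod>i\<in>I. p i)"
    and "\<And>i. i \<in> I \<Longrightarrow> \<not> p i dvd q"
  shows "q dvd 1"
  using assms by (induction I rule: finite_induct) (auto dest: dvd_cancel_prime_elem)


section \<open>Homaloidal polynomials\<close>

text \<open>A common nonzero factor \<open>s\<close> or \<open>t\<close> does not change a rational
  map, so both composites represent the identity.\<close>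

lemma birationalI:
  fixes g h :: "3 \<Rightarrow> 'a::field poly3"
  assumes "\<And>i. is_form d (g i)" "\<And>i. is_form e (h i)"
    and gh: "\<And>i. subst3 (g i) h = s * var3 i" "s \<noteq> 0"
    and hg: "\<And>i. subst3 (h i) g = t * var3 i" "t \<noteq> 0"
  shows "birational g"
proof -
  have "g 0 \<noteq> 0" using gh(1)[of 0] gh(2) by auto
  moreover have "h 0 \<noteq> 0" using hg(1)[of 0] hg(2) by auto
  ultimately have "rational_map g" "rational_map h"
    using assms(1,2) by (auto simp: rational_map_def)
  moreover have "rational_map (comp_map g h)" "rational_map (comp_map h g)"
  proof -
    have "\<exists>d. \<forall>i. is_form d (subst3 (g i) h)" "\<exists>d. \<forall>i. is_form d (subst3 (h i) g)"
      using is_form_subst3 assms(1,2) by blast+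
    moreover have "subst3 (g 0) h \<noteq> 0" "subst3 (h 0) g \<noteq> 0"
      using gh hg by simp_all
    ultimately show "rational_map (comp_map g h)" "rational_map (comp_map h g)"
      unfolding rational_map_def comp_map_def by blast+
  qed
  moreover have "same_map (comp_map g h) var3" "same_map (comp_map h g) var3"
    by (auto simp: same_map_def comp_map_def gh hg algebra_simps)
  ultimately show ?thesis unfolding birational_def by blast
qed

text \<open>If \<open>f = x * (x * r)\<close>, the product rule makes \<open>x\<close> divide every
  partial derivative, so \<open>x\<close> is a constant, and nonzero as \<open>f\<close> is.\<close>

lemma squarefree_if_partials_coprime:
  fixes f :: "'a::field poly3"
  assumes "f \<noteq> 0" "\<And>q. (\<And>i. q dvd partial3 i f) \<Longrightarrow> degree3 q = 0"
  shows "squarefree f"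
proof (rule squarefreeI)
  fix x assume "x\<^sup>2 dvd f"
  then obtain r where r: "f = x * (x * r)"
    by (metis dvdE mult.assoc power2_eq_square)
  have "x dvd partial3 i f" for i
    unfolding r partial3_mult by (simp add: dvd_add)
  then have "is_form 0 x" using assms(2) degree3_eq_0_iff by blast
  then obtain c where c: "x = const3 c" using is_form_0_const by blast
  with r \<open>f \<noteq> 0\<close> have "const3 c * const3 (1 / c) = 1"
    by (auto simp flip: const3_mult)
  then show "x dvd 1" unfolding c by (metis dvd_triv_left)
qed

lemma homaloidal_curveI:
  fixes f :: "'a::alg_closed_field poly3"
  assumes "is_form (Suc d) f" "f \<noteq> 0" "\<And>q. (\<And>i. q dvd partial3 i f) \<Longrightarrow> degree3 q = 0"
    and "birational (polar_map f)"
  shows "homaloidal_curve (zero_locus f)"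
proof -
  have "squarefree f" using assms(2,3) by (rule squarefree_if_partials_coprime)
  then have "reduced_equation f (zero_locus f)"
    using assms(1) by (auto simp: reduced_equation_def)
  moreover have "homaloidal f"
    unfolding homaloidal_def using assms(1,3,4) by fastforce
  ultimately show ?thesis by (auto simp: homaloidal_curve_def)
qed

section \<open>Line arrangements\<close>

lemma prime_elem_dvd_prod:
  assumes "prime_elem p" "finite A" "p dvd (\<Prod>i\<in>A. f i)"
  shows "\<exists>i\<in>A. p dvd f i"
  using assms(2,3)
  by (induction A rule: finite_induct)
    (use assms(1) in \<open>auto simp: prime_elem_dvd_mult_iff prime_elem_not_unit\<close>)

lemma zero_locus_prod:
  fixes f :: "'b \<Rightarrow> 'a::field poly3"
  assumes "finite I"
  shows "zero_locus (\<Prod>i\<in>I. f i) = (\<Union>i\<in>I. zero_locus (f i))"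
  using assms by (auto simp: zero_locus_def eval3_prod)

lemma zero_locus_subset_if_dvd:
  fixes f g :: "'a::field poly3"
  assumes "f dvd g"
  shows "zero_locus f \<subseteq> zero_locus g"
  using assms by (auto simp: zero_locus_def eval3_mult elim!: dvdE)

text \<open>Non-divisibility says that the forms are pairwise non-proportional, so that they define
  distinct lines.\<close>

locale lines =
  fixes I :: "'b set" and a :: "'b \<Rightarrow> 3 \<Rightarrow> 'a::field"
  assumes finite: "finite I"
    and nonzero: "i \<in> I \<Longrightarrow> lin3 (a i) \<noteq> 0"
    and distinct: "i \<in> I \<Longrightarrow> j \<in> I \<Longrightarrow> i \<noteq> j \<Longrightarrow> \<not> lin3 (a i) dvd lin3 (a j)"
begin

text \<open>Write the product as \<open>l * r\<close> with \<open>l\<close> the given form. Modulo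
  \<open>l\<close> its \<open>k\<close>-th derivative is \<open>a i k * r\<close>; for
  \<open>a i k\<close> nonzero the prime \<open>l\<close> would divide \<open>r\<close> and so
  another of the forms.\<close>

lemma line_not_dvd_partials:
  assumes i: "i \<in> I"
  shows "\<exists>k. \<not> lin3 (a i) dvd partial3 k (\<Prod>j\<in>I. lin3 (a j))"
proof (rule ccontr)
  assume "\<nexists>k. \<not> lin3 (a i) dvd partial3 k (\<Prod>j\<in>I. lin3 (a j))"
  then have dvd: "lin3 (a i) dvd partial3 k (\<Prod>j\<in>I. lin3 (a j))" for k by blast
  let ?r = "\<Prod>j\<in>I - {i}. lin3 (a j)"
  have f: "(\<Prod>j\<in>I. lin3 (a j)) = lin3 (a i) * ?r"
    using finite i by (simp add: prod.remove)
  obtain k where k: "a i k \<noteq> 0" using nonzero[OF i] by (auto simp: lin3_eq_0_iff)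
  have "lin3 (a i) dvd const3 (a i k) * ?r"
    using dvd[of k] unfolding f by (simp add: partial3_mult dvd_add_left_iff)
  then have "lin3 (a i) dvd const3 (1 / a i k) * (const3 (a i k) * ?r)"
    by (rule dvd_mult)
  also have "const3 (1 / a i k) * (const3 (a i k) * ?r) = ?r"
    using k by (simp flip: const3_mult mult.assoc)
  finally have "lin3 (a i) dvd ?r" .
  then obtain j where "j \<in> I - {i}" "lin3 (a i) dvd lin3 (a j)"
    using prime_elem_dvd_prod[OF prime_elem_lin3[OF nonzero[OF i]]] finite
    by (metis finite_Diff)
  then show False using distinct i by blast
qed

text \<open>By Euler's formula a common factor of the partial derivatives divides the product itself.\<close>

lemma partials_coprime:
  assumes "of_nat (card I) \<noteq> (0 :: 'a)"
    and q: "\<And>i. q dvd partial3 i (\<Prod>j\<in>I. lin3 (a j))"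
  shows "degree3 q = 0"
proof (rule degree3_unit)
  let ?f = "\<Prod>j\<in>I. lin3 (a j)" and ?n = "of_nat (card I) :: 'a"
  have "is_form (card I) ?f"
    using is_form_prod[OF finite, of "Suc 0" "\<lambda>j. lin3 (a j)"] by simp
  then have "(\<Sum>i\<in>UNIV. var3 i * partial3 i ?f) = const3 ?n * ?f"
    unfolding const3_of_nat by (rule euler_partial3)
  moreover have "q dvd (\<Sum>i\<in>UNIV. var3 i * partial3 i ?f)"
    by (intro dvd_sum dvd_mult q)
  ultimately have "q dvd const3 (1 / ?n) * (const3 ?n * ?f)" by simp
  also have "const3 (1 / ?n) * (const3 ?n * ?f) = ?f"
    using assms(1) by (simp flip: const3_mult mult.assoc)
  finally have "q dvd ?f" .
  then show "q dvd 1"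
  proof (rule dvd_prod_prime_elem[OF finite, rotated])
    fix i assume "i \<in> I"
    then show "prime_elem (lin3 (a i))" by (intro prime_elem_lin3 nonzero)
    show "\<not> lin3 (a i) dvd q"
      using line_not_dvd_partials[OF \<open>i \<in> I\<close>] q dvd_trans by blast
  qed
qed

end


section \<open>Near-pencils\<close>

definition dot :: "(3 \<Rightarrow> 'b::comm_ring_1) \<Rightarrow> (3 \<Rightarrow> 'b) \<Rightarrow> 'b" where
  "dot u v = (\<Sum>i\<in>UNIV. u i * v i)"

definition cross :: "(3 \<Rightarrow> 'b::comm_ring_1) \<Rightarrow> (3 \<Rightarrow> 'b) \<Rightarrow> 3 \<Rightarrow> 'b" where
  "cross u v i = (if i = 0 then u 1 * v 2 - u 2 * v 1
     else if i = 1 then u 2 * v 0 - u 0 * v 2 else u 0 * v 1 - u 1 * v 0)"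

text \<open>Lagrange's expansion of the vector triple product.\<close>

lemma cross_cross_right: "cross u (cross v w) i = v i * dot u w - w i * dot u v"
  by (induction i rule: three_cases) (simp_all add: cross_def dot_def sum_three algebra_simps)

lemma cross_cross_left: "cross (cross u v) w i = v i * dot u w - u i * dot v w"
  by (induction i rule: three_cases) (simp_all add: cross_def dot_def sum_three algebra_simps)

lemma dot_cross [simp]: "dot u (cross u v) = 0" "dot (cross u v) v = 0"
  by (simp_all add: cross_def dot_def sum_three algebra_simps)

lemma cross_self [simp]: "cross u u i = 0"
  by (simp add: cross_def algebra_simps)

lemma cross_combine_right: "cross u (\<lambda>i. s * v i + t * w i) i = s * cross u v i + t * cross u w i"
  by (simp add: cross_def algebra_simps)

lemma cross_combine_left: "cross (\<lambda>i. s * v i + t * w i) u i = s * cross v u i + t * cross w u i"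
  by (simp add: cross_def algebra_simps)

lemma dot_combine_right: "dot u (\<lambda>i. s * v i + t * w i) = s * dot u v + t * dot u w"
  by (simp add: dot_def sum_three algebra_simps)

lemma dot_combine_left: "dot (\<lambda>i. s * v i + t * w i) u = s * dot v u + t * dot w u"
  by (simp add: dot_def sum_three algebra_simps)

lemma subst3_dot: "subst3 (dot u v) w = dot (\<lambda>i. subst3 (u i) w) (\<lambda>i. subst3 (v i) w)"
  by (simp add: dot_def sum_three subst3_ring)

lemma subst3_cross: "subst3 (cross u v i) w = cross (\<lambda>i. subst3 (u i) w) (\<lambda>i. subst3 (v i) w) i"
  by (simp add: cross_def subst3_ring)

lemma const3_dot: "const3 (dot u v) = dot (\<lambda>i. const3 (u i)) (\<lambda>i. const3 (v i))"
  by (simp add: dot_def const3_sum const3_mult)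

lemma subst3_lin3_dot: "subst3 (lin3 u) w = dot (\<lambda>i. const3 (u i)) w"
  by (simp add: subst3_lin3 dot_def)

lemma lin3_dot: "lin3 u = dot (\<lambda>i. const3 (u i)) var3"
  by (simp add: lin3_def dot_def)

text \<open>The coefficient of \<open>x_k\<close> in component \<open>i\<close> is component
  \<open>i\<close> of the cross product of the \<open>k\<close>-th unit vector with
  \<open>z\<close>.\<close>

lemma cross_var3_const3:
  "cross var3 (\<lambda>j. const3 (z j)) i = lin3 (\<lambda>k. cross (\<lambda>j. if j = k then 1 else 0) z i)"
  by (induction i rule: three_cases)
    (simp_all add: cross_def lin3_def sum_three const3_minus algebra_simps)

section \<open>A pencil through a point and a line missing it\<close>

text \<open>\<open>b\<close> indexes the line that misses \<open>z\<close>; the coordinates of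
  \<open>z\<close> are scaled so that its form has value 1 there. Counting the pencil as
  \<open>k + 2\<close> lines keeps subtraction out of the degrees.\<close>

locale pencil_and_line = lines "insert b I" a for I :: "'b set" and b and a :: "'b \<Rightarrow> 3 \<Rightarrow> 'a::field" +
  fixes z :: "3 \<Rightarrow> 'a" and k :: nat
  assumes b: "b \<notin> I"
    and card: "card I = k + 2"
    and char: "of_nat (card I) = (0 :: 'a)"
    and through: "i \<in> I \<Longrightarrow> dot (a i) z = 0"
    and missing: "dot (a b) z = 1"
begin

abbreviation Z :: "3 \<Rightarrow> 'a poly3" where "Z i \<equiv> const3 (z i)"
abbreviation M :: "3 \<Rightarrow> 'a poly3" where "M i \<equiv> const3 (a b i)"
abbreviation m :: "'a poly3" where "m \<equiv> lin3 (a b)"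
abbreviation c :: "3 \<Rightarrow> 'a poly3" where "c \<equiv> cross var3 Z"

definition g :: "'a poly3" where "g = (\<Prod>i\<in>I. lin3 (a i))"

sublocale pencil: lines I a
  by standard (use finite nonzero distinct in auto)

lemma dot_M_Z [simp]: "dot M Z = 1"
  using missing by (simp flip: const3_dot)

lemma form_g: "is_form (k + 2) g"
  using is_form_prod[OF pencil.finite, of "Suc 0" "\<lambda>j. lin3 (a j)"] by (simp add: g_def card)

lemma g_nonzero: "g \<noteq> 0"
  using pencil.finite nonzero by (simp add: g_def)

lemma product_eq: "(\<Prod>i\<in>insert b I. lin3 (a i)) = m * g"
  using pencil.finite b by (simp add: g_def)

text \<open>The derivative in direction \<open>z\<close> kills every linear form vanishing at
  \<open>z\<close>, hence their product.\<close>

lemma dot_partial_z: "dot (\<lambda>i. partial3 i g) Z = 0"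
proof -
  have "dot (\<lambda>i. partial3 i (\<Prod>j\<in>J. lin3 (a j))) Z = 0" if "finite J" "J \<subseteq> I" for J
    using that
  proof (induction J rule: finite_induct)
    case (insert j J)
    have "dot (\<lambda>i. partial3 i (\<Prod>j\<in>insert j J. lin3 (a j))) Z
        = dot (\<lambda>i. (\<Prod>j\<in>J. lin3 (a j)) * const3 (a j i)
            + lin3 (a j) * partial3 i (\<Prod>j\<in>J. lin3 (a j))) Z"
      using insert.hyps by (simp add: partial3_mult mult.commute)
    also have "\<dots> = 0"
      unfolding dot_combine_left using insert through[of j] by (simp flip: const3_dot)
    finally show ?case .
  qed (simp add: dot_def)
  from this[OF pencil.finite order.refl] show ?thesis by (simp add: g_def)
qed

text \<open>Euler's formula, where the degree \<open>k + 2\<close> is 0 in the field.\<close>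

lemma dot_partial_var: "dot (\<lambda>i. partial3 i g) var3 = 0"
proof -
  have "dot (\<lambda>i. partial3 i g) var3 = of_nat (k + 2) * g"
    using euler_partial3[OF form_g] by (simp add: dot_def mult.commute)
  also have "of_nat (k + 2) = const3 (of_nat (card I) :: 'a)"
    by (simp only: const3_of_nat card)
  finally show ?thesis by (simp add: char)
qed

text \<open>The gradient of \<open>g\<close> is orthogonal to \<open>z\<close> and, as \<open>p\<close> divides the degree of \<open>g\<close>, also to
  \<open>(x\<^sub>0, x\<^sub>1, x\<^sub>2)\<close>; so it is a multiple of their cross product.\<close>

lemma gradient: "\<exists>h. \<forall>i. partial3 i g = c i * h"
proof -
  let ?d = "\<lambda>i. partial3 i g"
  \<comment> \<open>The triple product expands into multiples of the two vanishing dot products; its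
    components are the proportionality relations \<open>swap\<close>.\<close>
  have "cross ?d c i = 0" for i
    by (simp add: cross_cross_right dot_partial_z dot_partial_var)
  from this[of 0] this[of 1] this[of 2]
  have swap: "c i * ?d j = c j * ?d i" for i j
    by (induction i rule: three_cases; induction j rule: three_cases)
      (simp_all add: cross_def[of ?d] mult.commute)
  \<comment> \<open>\<open>e i\<close> is the coefficient vector of the linear form
    \<open>c i\<close>.\<close>
  define e where "e i = (\<lambda>l. cross (\<lambda>j. if j = l then 1 else 0) z i)" for i
  have c: "c i = lin3 (e i)" for i by (simp add: cross_var3_const3 e_def)
  \<comment> \<open>Given a nonzero coordinate of \<open>z\<close>, let \<open>i\<close> and
    \<open>j\<close> be the two other indices: \<open>c i\<close> lacks \<open>x_i\<close> but
    contains \<open>x_j\<close>, and \<open>c j\<close> contains \<open>x_i\<close>.\<close>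
  have "\<exists>i j. e i i = 0 \<and> e i j \<noteq> 0 \<and> e j i \<noteq> 0"
  proof -
    have "dot (a b) z \<noteq> 0" by (simp add: missing)
    then have "z 0 \<noteq> 0 \<or> z 1 \<noteq> 0 \<or> z 2 \<noteq> 0" by (auto simp: dot_def sum_three)
    moreover have "z 2 \<noteq> 0 \<Longrightarrow> e 0 0 = 0 \<and> e 0 1 \<noteq> 0 \<and> e 1 0 \<noteq> 0"
      "z 1 \<noteq> 0 \<Longrightarrow> e 0 0 = 0 \<and> e 0 2 \<noteq> 0 \<and> e 2 0 \<noteq> 0"
      "z 0 \<noteq> 0 \<Longrightarrow> e 1 1 = 0 \<and> e 1 2 \<noteq> 0 \<and> e 2 1 \<noteq> 0"
      by (simp_all add: e_def cross_def)
    ultimately show ?thesis by blast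
  qed
  then obtain i j where ij: "e i i = 0" "e i j \<noteq> 0" "e j i \<noteq> 0" by blast
  have ci: "c i \<noteq> 0" unfolding c lin3_eq_0_iff using ij by blast
  \<comment> \<open>A constant multiple of \<open>c i\<close> lacks \<open>x_i\<close>, which
    \<open>c j\<close> contains.\<close>
  have "\<not> c i dvd c j"
  proof
    assume "c i dvd c j"
    then obtain t where "e j l = t * e i l" for l
      using lin3_dvd_lin3 ci unfolding c by metis
    from this[of i] ij show False by simp
  qed
  moreover have "c i dvd c j * ?d i" by (metis swap dvd_triv_left)
  ultimately have "c i dvd ?d i"
    using prime_elem_lin3 ci unfolding c by (metis prime_elem_dvd_multD)
  then obtain h where h: "?d i = c i * h" by (elim dvdE)
  have "?d l = c l * h" for l
  proof -
    have "c i * ?d l = c i * (c l * h)" by (simp only: swap[of i l] h mult.left_commute)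
    then show ?thesis using ci by simp
  qed
  then show ?thesis by blast
qed

definition h :: "'a poly3" where "h = (SOME h. \<forall>i. partial3 i g = c i * h)"

lemma partial_g: "partial3 i g = c i * h"
  using someI_ex[OF gradient] unfolding h_def by (rule spec)

text \<open>Otherwise all partial derivatives of \<open>g\<close> vanish, and every line of the
  pencil divides them.\<close>

lemma h_nonzero: "h \<noteq> 0"
proof
  assume "h = 0"
  obtain i where "i \<in> I" using card by (cases "I = {}") auto
  from pencil.line_not_dvd_partials[OF this] show False
    unfolding g_def [symmetric] partial_g \<open>h = 0\<close> by simp
qed

lemma c_nonzero: "\<exists>i. c i \<noteq> 0"
proof (rule ccontr)
  assume "\<nexists>i. c i \<noteq> 0"
  then have "c i = 0" for i by blast
  moreover obtain i where "i \<in> I" using card by (cases "I = {}") auto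
  note pencil.line_not_dvd_partials[OF this]
  ultimately show False
    unfolding g_def [symmetric] partial_g by simp
qed

lemma form_c: "is_form (Suc 0) (c i)"
  unfolding cross_var3_const3 by simp

lemma form_h: "is_form k h"
proof -
  obtain i where "c i \<noteq> 0" using c_nonzero by blast
  moreover have "is_form (Suc k) (c i * h)"
    unfolding partial_g [symmetric] using form_g by (intro is_form_partial) simp
  ultimately show ?thesis using is_form_cofactor[OF form_c] by simp
qed

text \<open>The projection from \<open>z\<close> onto the line \<open>b\<close>.\<close>

definition T :: "3 \<Rightarrow> 'a poly3" where "T i = var3 i - m * Z i"

text \<open>Subtracting a multiple of \<open>z\<close> from the point does not change the value of a
  linear form that vanishes at \<open>z\<close>.\<close>

lemma subst3_lin3_T: "subst3 (lin3 u) T = lin3 u" if "dot u z = 0"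
proof -
  have "T = (\<lambda>i. 1 * var3 i + (- m) * Z i)" by (simp add: T_def fun_eq_iff)
  then show ?thesis
    using that by (simp only: subst3_lin3_dot dot_combine_right) (simp add: lin3_dot flip: const3_dot)
qed

lemma g_T: "subst3 g T = g"
  unfolding g_def subst3_prod by (intro prod.cong) (auto simp: subst3_lin3_T through)

text \<open>Like \<open>g\<close>, its derivatives are built from constants and linear forms
  vanishing at \<open>z\<close>.\<close>

lemma partial_g_T: "subst3 (partial3 i g) T = partial3 i g"
proof -
  have "subst3 (partial3 i (\<Prod>j\<in>J. lin3 (a j))) T = partial3 i (\<Prod>j\<in>J. lin3 (a j))"
    if "finite J" "J \<subseteq> I" for J
    using that
  proof (induction J rule: finite_induct)
    case (insert j J)
    have "subst3 (\<Prod>j\<in>J. lin3 (a j)) T = (\<Prod>j\<in>J. lin3 (a j))"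
      unfolding subst3_prod using insert.prems by (intro prod.cong) (auto simp: subst3_lin3_T through)
    with insert through[of j] show ?case
      by (simp add: partial3_mult subst3_ring subst3_lin3_T)
  qed simp
  from this[OF pencil.finite order.refl] show ?thesis by (simp add: g_def)
qed

lemma c_T: "subst3 (c i) T = c i"
proof -
  have "T = (\<lambda>i. 1 * var3 i + (- m) * Z i)" by (simp add: T_def fun_eq_iff)
  then have "cross T Z i = c i" by (simp only: cross_combine_left) simp
  then show ?thesis by (simp add: subst3_cross)
qed

text \<open>In the invariant product \<open>c i * h\<close> the factor \<open>c i\<close> is itself
  invariant and cancels.\<close>

lemma h_T: "subst3 h T = h"
proof -
  obtain i where i: "c i \<noteq> 0" using c_nonzero by blast
  have "c i * subst3 h T = c i * h"
    using partial_g_T[of i] by (simp add: partial_g subst3_mult c_T)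
  then show ?thesis using i by simp
qed

text \<open>The values of \<open>g\<close> and \<open>h\<close> depend on the projection from
  \<open>z\<close> only, so the component of \<open>y\<close> along \<open>z\<close> may be
  removed.\<close>

lemma subst3_T: "subst3 g y = subst3 g (\<lambda>i. y i - dot M y * Z i)"
  "subst3 h y = subst3 h (\<lambda>i. y i - dot M y * Z i)"
proof -
  have "subst3 (T i) y = y i - dot M y * Z i" for i
    by (simp add: T_def subst3_ring subst3_lin3_dot)
  then show "subst3 g y = subst3 g (\<lambda>i. y i - dot M y * Z i)"
    "subst3 h y = subst3 h (\<lambda>i. y i - dot M y * Z i)"
    using subst3_subst3[of g T y] subst3_subst3[of h T y] by (simp_all add: g_T h_T)
qed

text \<open>A point \<open>x\<close> can be recovered from $y = \nabla(mg)(x) = g(x) M + m(x) h(x)\, x \times z$: the point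
  $M \times y = m(x) h(x) (x - m(x) z)$ is its projection from \<open>z\<close>, and $y \cdot z = g(x)$ then
  determines $m(x)$.\<close>

abbreviation W :: "3 \<Rightarrow> 'a poly3" where "W \<equiv> cross M var3"
definition r :: "'a poly3" where "r = dot var3 Z * subst3 h W"
definition inverse_map :: "3 \<Rightarrow> 'a poly3" where
  "inverse_map i = r * W i + subst3 g W * Z i"

abbreviation \<Phi> :: "3 \<Rightarrow> 'a poly3" where "\<Phi> \<equiv> polar_map (m * g)"

section \<open>Composites of the polar map and its inverse\<close>

lemma polar_map_eq: "\<Phi> = (\<lambda>i. g * M i + (m * h) * c i)"
  by (simp add: fun_eq_iff polar_map_def partial3_mult partial_g algebra_simps)

text \<open>In the cross product of \<open>M\<close> with the polar map the multiple of
  \<open>M\<close> drops out, and the triple product turns M \<times> (x \<times> z) into x - m z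
  since M . z = 1.\<close>

lemma subst3_W_polar: "subst3 (W i) \<Phi> = (m * h) * T i"
proof -
  have "subst3 (W i) \<Phi> = cross M \<Phi> i" by (simp add: subst3_cross)
  also have "\<dots> = (m * h) * cross M c i"
    unfolding polar_map_eq cross_combine_right by simp
  also have "cross M c i = T i"
    by (simp add: cross_cross_right T_def lin3_dot)
  finally show ?thesis .
qed

text \<open>Homogeneity extracts the factor \<open>m * h\<close>, and what remains is invariant
  under \<open>T\<close>.\<close>

lemma subst3_g_W_polar: "subst3 (subst3 g W) \<Phi> = (m * h) ^ (k + 2) * g"
  by (simp only: subst3_subst3 subst3_W_polar subst3_scale[OF form_g] g_T)

lemma subst3_h_W_polar: "subst3 (subst3 h W) \<Phi> = (m * h) ^ k * h"
  by (simp only: subst3_subst3 subst3_W_polar subst3_scale[OF form_h] h_T)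

lemma subst3_dot_polar: "subst3 (dot var3 Z) \<Phi> = g"
proof -
  have "subst3 (dot var3 Z) \<Phi> = dot \<Phi> Z" by (simp add: subst3_dot)
  then show ?thesis unfolding polar_map_eq dot_combine_left by simp
qed

text \<open>The first term of \<open>inverse_map\<close> becomes the stated factor times x - m z,
  the second the same factor times m z; the multiples of \<open>z\<close> cancel.\<close>

lemma inverse_polar: "subst3 (inverse_map i) \<Phi> = ((m * h) ^ (k + 1) * g * h) * var3 i"
proof -
  have "subst3 (inverse_map i) \<Phi> = (g * ((m * h) ^ k * h)) * ((m * h) * T i) + (m * h) ^ (k + 2) * g * Z i"
    by (simp add: inverse_map_def r_def subst3_ring subst3_W_polar subst3_g_W_polar
        subst3_h_W_polar subst3_dot_polar)
  then show ?thesis by (simp add: T_def algebra_simps)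
qed

text \<open>As M . W = 0, the form \<open>m\<close> takes the value g(W) on the inverse map, while
  \<open>g\<close> and \<open>h\<close> only see its part r W. The cross product with
  \<open>z\<close> is again a triple product.\<close>

lemma polar_inverse: "subst3 (\<Phi> i) inverse_map = (subst3 g W * r ^ (k + 1) * subst3 h W) * var3 i"
proof -
  have inv: "inverse_map = (\<lambda>i. r * W i + subst3 g W * Z i)"
    by (simp add: fun_eq_iff inverse_map_def)
  have m: "dot M inverse_map = subst3 g W"
    unfolding inv dot_combine_right by simp
  have "subst3 g inverse_map = r ^ (k + 2) * subst3 g W"
    by (simp only: subst3_T(1)[of inverse_map] m)
      (simp add: inverse_map_def subst3_scale[OF form_g])
  moreover have "subst3 h inverse_map = r ^ k * subst3 h W"
    by (simp only: subst3_T(2)[of inverse_map] m)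
      (simp add: inverse_map_def subst3_scale[OF form_h])
  moreover have "cross inverse_map Z i = r * (var3 i - M i * dot var3 Z)"
    unfolding inv cross_combine_left by (simp add: cross_cross_left)
  ultimately have "subst3 (\<Phi> i) inverse_map = r ^ (k + 2) * subst3 g W * M i
      + subst3 g W * (r ^ k * subst3 h W) * (r * (var3 i - M i * dot var3 Z))"
    by (simp add: polar_map_eq subst3_ring subst3_cross subst3_lin3_dot m)
  also have "\<dots> = subst3 g W * r ^ (k + 1)
      * (r * M i + subst3 h W * (var3 i - M i * dot var3 Z))"
    by (simp add: algebra_simps)
  \<comment> \<open>The multiples of \<open>M i\<close> cancel because \<open>r\<close> is (x . z)
    h(W).\<close>
  also have "r * M i + subst3 h W * (var3 i - M i * dot var3 Z) = subst3 h W * var3 i"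
    by (simp add: r_def algebra_simps)
  finally show ?thesis by (simp add: algebra_simps)
qed

lemma form_W: "is_form (Suc 0) (W i)"
  unfolding cross_def by (auto intro!: is_form_diff is_form_const_mult)

lemma form_inverse_map: "is_form (k + 2) (inverse_map i)"
proof -
  have "is_form k (subst3 h W)" "is_form (k + 2) (subst3 g W)"
    using is_form_subst3[OF form_h form_W] is_form_subst3[OF form_g form_W] by simp_all
  moreover have "is_form (Suc 0) (dot var3 Z)"
    unfolding dot_def by (subst mult.commute) (intro is_form_sum is_form_const_mult is_form_var)
  ultimately have "is_form (Suc 0 + k + Suc 0) (r * W i)" "is_form (k + 2) (Z i * subst3 g W)"
    unfolding r_def by (blast intro: is_form_mult form_W is_form_const_mult)+
  then show ?thesis
    unfolding inverse_map_def by (intro is_form_add) (simp_all add: mult.commute)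
qed

lemma form_product: "is_form (Suc (k + 2)) (m * g)"
  using is_form_mult[OF is_form_lin3 form_g] by simp

lemma birational_polar_map: "birational \<Phi>"
proof (rule birationalI[OF _ form_inverse_map polar_inverse _ inverse_polar])
  show "is_form (k + 2) (\<Phi> i)" for i
    unfolding polar_map_def by (rule is_form_partial[OF form_product])
  have m: "m \<noteq> 0" using nonzero by simp
  then show "(m * h) ^ (k + 1) * g * h \<noteq> 0" using g_nonzero h_nonzero by simp
  \<comment> \<open>Each of these polynomials is nonzero because its composite with
    \<open>\<Phi>\<close> is.\<close>
  have "subst3 g W \<noteq> 0" using subst3_g_W_polar m g_nonzero h_nonzero by force
  moreover have "subst3 h W \<noteq> 0" using subst3_h_W_polar m h_nonzero by force
  moreover have "dot var3 Z \<noteq> 0" using subst3_dot_polar g_nonzero by force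
  ultimately show "subst3 g W * r ^ (k + 1) * subst3 h W \<noteq> 0" by (simp add: r_def)
qed

end


section \<open>From a near-pencil as a point set to its equation\<close>

lemma var3_eq_lin3: "var3 i = lin3 (\<lambda>j. if j = i then 1 else 0)"
  by (induction i rule: three_cases) (simp_all add: lin3_def sum_three)

lemma prime_elem_var3: "prime_elem (var3 i :: 'a::field poly3)"
  using prime_elem_lin3 var3_neq_0[of i] unfolding var3_eq_lin3 by blast

lemma near_pencil_homaloidal_curve:
  fixes F :: "('a::alg_closed_field ^ 3) set set"
  assumes "near_pencil n F" "n \<ge> 2" "of_nat n = (0 :: 'a)"
  shows "homaloidal_curve F"
proof -
  obtain pt P L where pt: "pt \<in> proj_plane" and P: "finite P" "card P = n"
    and through: "\<forall>K\<in>P. proj_line K \<and> pt \<in> K"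
    and L: "proj_line L" "pt \<notin> L" and F: "F = \<Union>P \<union> L"
    using assms(1) unfolding near_pencil_def by blast
  obtain v where v: "v \<noteq> 0" "pt = proj_point v"
    using pt by (auto simp: proj_plane_def)
  have "\<exists>a. lin3 a \<noteq> 0 \<and> K = zero_locus (lin3 a)" if "K \<in> insert L P" for K
    using that L(1) through is_form_1_imp_lin3 unfolding proj_line_def by (metis insertE)
  then obtain a where a: "lin3 (a K) \<noteq> 0" "zero_locus (lin3 (a K)) = K"
    if "K \<in> insert L P" for K by metis
  have incident: "dot (a K) (($) v) = 0" if "K \<in> P" for K
  proof -
    have "pt \<in> zero_locus (lin3 (a K))" using a(2)[of K] through that by auto
    \<comment> \<open>The zero locus only provides some representative \<open>w\<close> of the
      point; linearity transfers the equation to \<open>v\<close>.\<close>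
    then obtain w where w: "proj_point w = pt" "eval3 (lin3 (a K)) w = 0"
      unfolding zero_locus_def by blast
    have "v \<in> proj_point v" unfolding proj_point_def by (auto intro: exI[of _ 1])
    then obtain s where "v = s *s w" using w v unfolding proj_point_def by blast
    then have "eval3 (lin3 (a K)) v = s * eval3 (lin3 (a K)) w"
      by (simp add: eval3_lin3 sum_three algebra_simps)
    then show ?thesis using w by (simp add: eval3_lin3 dot_def)
  qed
  \<comment> \<open>Dividing \<open>v\<close> by \<open>d\<close> achieves the normalisation
    \<open>dot (a b) z = 1\<close> of the locale.\<close>
  define d where "d = dot (a L) (($) v)"
  have d: "d \<noteq> 0"
  proof
    assume "d = 0"
    then have "eval3 (lin3 (a L)) v = 0" by (simp add: d_def eval3_lin3 dot_def)
    then have "pt \<in> zero_locus (lin3 (a L))" using v by (auto simp: zero_locus_def)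
    then show False using a(2)[of L] L by simp
  qed
  have scaled: "dot u (\<lambda>i. v $ i / d) = dot u (($) v) / d" for u
    by (simp add: dot_def sum_divide_distrib)
  have "L \<notin> P" using L through by blast
  interpret pencil_and_line P L a "\<lambda>i. v $ i / d" "n - 2"
  proof
    show "finite (insert L P)" using P by simp
    show "lin3 (a K) \<noteq> 0" if "K \<in> insert L P" for K by (rule a(1)[OF that])
    show "\<not> lin3 (a K) dvd lin3 (a K')"
      if K: "K \<in> insert L P" and K': "K' \<in> insert L P" and "K \<noteq> K'" for K K'
    proof
      \<comment> \<open>The forms are proportional by a nonzero constant, hence divide each other
        and have the same zero locus, although \<open>K\<close> and \<open>K'\<close>
        differ.\<close>
      assume dvd: "lin3 (a K) dvd lin3 (a K')"
      obtain c where c: "a K' i = c * a K i" for i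
        using lin3_dvd_lin3[OF dvd a(1)[OF K]] by blast
      have "c \<noteq> 0" using a(1)[OF K'] c by (auto simp: lin3_eq_0_iff)
      then have "const3 (a K i) = const3 (1 / c) * const3 (a K' i)" for i
        by (simp add: c flip: const3_mult)
      then have "lin3 (a K) = const3 (1 / c) * lin3 (a K')"
        by (simp only: lin3_def sum_distrib_left mult.assoc)
      then have "lin3 (a K') dvd lin3 (a K)" by simp
      with dvd have "zero_locus (lin3 (a K)) = zero_locus (lin3 (a K'))"
        by (intro equalityI zero_locus_subset_if_dvd)
      then show False using a(2)[OF K] a(2)[OF K'] \<open>K \<noteq> K'\<close> by simp
    qed
    show "L \<notin> P" by fact
    show "card P = n - 2 + 2" using P assms(2) by simp
    show "of_nat (card P) = (0 :: 'a)" using P assms(3) by simp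
    show "dot (a K) (\<lambda>i. v $ i / d) = 0" if "K \<in> P" for K
      using that by (simp add: scaled incident)
    show "dot (a L) (\<lambda>i. v $ i / d) = 1" using d by (simp add: scaled flip: d_def)
  qed
  have "zero_locus (\<Prod>K\<in>insert L P. lin3 (a K)) = (\<Union>K\<in>insert L P. zero_locus (lin3 (a K)))"
    by (rule zero_locus_prod[OF finite])
  also have "\<dots> = (\<Union>K\<in>insert L P. K)" using a(2) by (intro SUP_cong) auto
  also have "\<dots> = F" by (auto simp: F)
  finally have F': "zero_locus (m * g) = F" unfolding product_eq .
  \<comment> \<open>The whole arrangement has \<open>n + 1\<close> lines, and \<open>n + 1\<close>
    is 1 in the field, so Euler's formula shows its derivatives coprime.\<close>
  have "of_nat (card (insert L P)) \<noteq> (0 :: 'a)"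
    using P \<open>L \<notin> P\<close> assms(3) by simp
  then have "homaloidal_curve (zero_locus (m * g))"
    using nonzero g_nonzero
    by (intro homaloidal_curveI[OF form_product] birational_polar_map
        partials_coprime[unfolded product_eq]) auto
  then show ?thesis by (simp only: F')
qed

section \<open>The curves $G_n$\<close>

text \<open>Here $n = k + 3$: for $n = 2$ the number $n(n-1)-1 = 1$ has no prime divisor.\<close>

context
  fixes k :: nat and \<mu> \<nu> E :: "'a::field poly3"
  defines "\<mu> \<equiv> of_nat (k + 2)" and "\<nu> \<equiv> of_nat (k + 3)"
    and "E \<equiv> var3 1 ^ (k + 2) + \<mu> * var3 0 ^ (k + 1) * var3 2"
  assumes inverse: "of_nat ((k + 3) * (k + 2)) = (1 :: 'a)"
begin

definition curve_form :: "'a poly3" where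
  "curve_form = var3 0 * var3 1 * (var3 1 ^ (k + 2) + var3 0 ^ (k + 1) * var3 2)"

text \<open>For y the image of x, x_0 : x_1 = y_1 : \<open>\<nu>\<close> y_0 and E : x_0^(k+2) = y_0
  : y_2. With x_0 = y_1 and x_1 = \<open>\<nu>\<close> y_0 the second relation is solved for x_2,
  using 1/\<open>\<mu>\<close> = \<open>\<nu>\<close>; then the denominator y_2 y_1^(k+1) is
  cleared.\<close>

definition curve_inverse :: "3 \<Rightarrow> 'a poly3" where
  "curve_inverse i =
    (if i = 0 then var3 2 * var3 1 ^ (k + 2)
     else if i = 1 then \<nu> * var3 0 * var3 2 * var3 1 ^ (k + 1)
     else \<nu> * (var3 1 ^ (k + 2) * var3 0 - \<nu> ^ (k + 2) * var3 2 * var3 0 ^ (k + 2)))"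

lemma mult_eq_1: "\<nu> * \<mu> = 1"
proof -
  have "\<nu> * \<mu> = of_nat ((k + 3) * (k + 2))"
    by (simp only: \<mu>_def \<nu>_def of_nat_mult)
  also have "\<dots> = const3 (of_nat ((k + 3) * (k + 2)))"
    by (rule const3_of_nat [symmetric])
  finally have "\<nu> * \<mu> = const3 (of_nat ((k + 3) * (k + 2)))" .
  then show ?thesis by (simp only: inverse const3_1)
qed

lemma mult_cancel: "\<nu> * (\<mu> * x) = x"
  using mult_eq_1 by (simp flip: mult.assoc)

section \<open>The gradient of the curve equation\<close>

lemma partials_curve_form:
  "partial3 0 curve_form = var3 1 * E"
  "partial3 1 curve_form = \<nu> * var3 0 * E"
  "partial3 2 curve_form = var3 0 ^ (k + 2) * var3 1"
proof -
  \<comment> \<open>Differentiating a \<open>k\<close>-th power produces the exponent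
    \<open>k - 1\<close> with coefficient \<open>k\<close>; the disjunction covers
    \<open>k = 0\<close>, where the coefficient vanishes.\<close>
  have pow: "(of_nat k :: 'a poly3) = 0 \<or> var3 i * var3 i ^ (k - Suc 0) = (var3 i ^ k :: 'a poly3)" for i
    by (metis Suc_pred' not_gr_zero of_nat_0 power_Suc One_nat_def)
  show "partial3 0 curve_form = var3 1 * E"
    using pow[of 0] by (simp add: curve_form_def E_def \<mu>_def partial3_mult partial3_add partial3_power
        partial3_var algebra_simps)
  \<comment> \<open>The terms of the derivative by \<open>x_1\<close> have coefficients
    \<open>\<nu>\<close> and 1; writing 1 as \<open>\<nu> * \<mu>\<close> exhibits the same factor
    \<open>E\<close> as in the derivative by \<open>x_0\<close>.\<close>
  have "\<nu> * var3 0 * E = \<nu> * var3 0 * var3 1 ^ (k + 2) + \<nu> * (\<mu> * (var3 0 ^ (k + 2) * var3 2))"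
    by (simp add: E_def algebra_simps)
  then show "partial3 1 curve_form = \<nu> * var3 0 * E"
    using pow[of 1] by (simp only: mult_cancel)
      (simp add: curve_form_def \<nu>_def partial3_mult partial3_add partial3_power partial3_var
        algebra_simps)
  show "partial3 2 curve_form = var3 0 ^ (k + 2) * var3 1"
    by (simp add: curve_form_def partial3_mult partial3_add partial3_power partial3_var algebra_simps)
qed

lemma subst3_\<mu>_\<nu> [simp]: "subst3 \<mu> w = \<mu>" "subst3 \<nu> w = \<nu>"
  unfolding \<mu>_def \<nu>_def by (rule subst3_of_nat)+

lemma \<mu>_\<nu>_nonzero: "\<mu> \<noteq> 0" "\<nu> \<noteq> 0"
  using mult_eq_1 by auto

text \<open>Setting the variable in question to 0 leaves the nonzero terms x_1^(k+3) and
  \<open>\<nu>\<close> \<open>\<mu>\<close> x_0^(k+2) x_2.\<close>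

lemma not_var3_dvd: "\<not> var3 0 dvd var3 1 * E" "\<not> var3 1 dvd \<nu> * var3 0 * E"
proof -
  have *: "subst3 f (var3(i := 0)) = 0" if "var3 i dvd f" for f :: "'a poly3" and i
    using that by (auto simp: subst3_mult elim!: dvdE)
  show "\<not> var3 0 dvd var3 1 * E"
    using *[of 0 "var3 1 * E"] by (auto simp: E_def subst3_ring)
  show "\<not> var3 1 dvd \<nu> * var3 0 * E"
    using *[of 1 "\<nu> * var3 0 * E"] \<mu>_\<nu>_nonzero by (auto simp: E_def subst3_ring)
qed

lemma E_nonzero: "E \<noteq> 0"
  using not_var3_dvd(1) by auto

text \<open>The third derivative has only the prime factors \<open>x_0\<close> and
  \<open>x_1\<close>, and the first two derivatives keep these from dividing
  \<open>q\<close>.\<close>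

lemma partials_curve_form_coprime:
  assumes "\<And>i. q dvd partial3 i curve_form"
  shows "degree3 q = 0"
proof (rule degree3_unit)
  note q = assms[of 0] assms[of 1] assms[of 2]
  have 0: "\<not> var3 0 dvd q" and 1: "\<not> var3 1 dvd q"
    using q(1,2) not_var3_dvd dvd_trans unfolding partials_curve_form by blast+
  have "q dvd var3 0 ^ (k + 2)"
    using q(3) 1 dvd_cancel_prime_elem[OF prime_elem_var3]
    unfolding partials_curve_form mult.commute[of _ "var3 1"] by blast
  moreover have "q dvd var3 0 ^ l \<Longrightarrow> q dvd 1" for l
    by (induction l) (use 0 dvd_cancel_prime_elem[OF prime_elem_var3] in auto)
  ultimately show "q dvd 1" by blast
qed

lemma form_curve_form: "is_form (Suc (k + 3)) curve_form"
proof -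
  have x: "is_form l (var3 i ^ l :: 'a poly3)" for l i
    using is_form_power[OF is_form_var, of l i] by simp
  have "is_form (k + 1 + 1) (var3 0 ^ (k + 1) * var3 2 :: 'a poly3)"
    by (intro is_form_mult x) simp
  then have "is_form (k + 2) (var3 1 ^ (k + 2) + var3 0 ^ (k + 1) * var3 2 :: 'a poly3)"
    using is_form_add[OF x, of "k + 2"] by simp
  from is_form_mult[OF is_form_mult[OF is_form_var is_form_var] this]
  show ?thesis by (simp add: curve_form_def numeral_3_eq_3)
qed

lemma form_curve_inverse: "is_form (k + 3) (curve_inverse i)"
proof -
  have x: "is_form l (var3 i ^ l :: 'a poly3)" for l i
    using is_form_power[OF is_form_var, of l i] by simp
  have xx: "is_form (l + l') (var3 i ^ l * var3 j ^ l' :: 'a poly3)" for l l' i j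
    by (intro is_form_mult x)
  have "is_form 0 \<nu>" by (metis \<nu>_def const3_of_nat is_form_const)
  then have \<nu>: "is_form d f \<Longrightarrow> is_form d (\<nu> * f)" "is_form d f \<Longrightarrow> is_form d (\<nu> ^ l * f)" for d f l
    using is_form_mult[of 0 \<nu> d f] is_form_mult[OF is_form_power[of 0 \<nu> l], of d f] by simp_all
  have 1: "is_form (k + 3) (var3 2 * var3 1 ^ (k + 2) :: 'a poly3)"
    using xx[of 1 "k + 2" 2 1] by (simp add: numeral_3_eq_3)
  have "is_form (k + 2) (var3 2 * var3 1 ^ (k + 1) :: 'a poly3)"
    using xx[of 1 "k + 1" 2 1] by simp
  then have 2: "is_form (k + 3) (\<nu> * (var3 0 * (var3 2 * var3 1 ^ (k + 1))))"
    using is_form_mult[OF is_form_var, of "k + 2"] by (intro \<nu>) (simp add: numeral_3_eq_3)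
  have 3: "is_form (k + 3) (\<nu> * (var3 1 ^ (k + 2) * var3 0 - \<nu> ^ (k + 2) * (var3 2 * var3 0 ^ (k + 2))))"
    using xx[of "k + 2" 1 1 0] xx[of 1 "k + 2" 2 0] by (intro \<nu> is_form_diff) (simp_all add: numeral_3_eq_3)
  show ?thesis
    using 1 2 3 unfolding curve_inverse_def by (simp only: mult.assoc split: if_split) blast
qed

section \<open>Composites of the polar map of the curve with its inverse\<close>

lemma curve_inverse_polar:
  "subst3 (curve_inverse i) (polar_map curve_form)
    = (var3 0 ^ (k + 1) * var3 0 ^ (k + 2) * var3 1 * \<nu> ^ (k + 2) * E ^ (k + 2)) * var3 i"
proof (induction i rule: three_cases)
  case 3
  have "subst3 (curve_inverse 2) (polar_map curve_form) =
      \<nu> * (\<nu> ^ (k + 2) * var3 0 ^ (k + 2) * E ^ (k + 2) * var3 1 * (E - var3 1 ^ (k + 2)))"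
    by (simp add: curve_inverse_def polar_map_def partials_curve_form subst3_ring
        power_mult_distrib algebra_simps)
  \<comment> \<open>\<open>E\<close> is linear in \<open>x_2\<close>: removing its pure power of
    \<open>x_1\<close> recovers \<open>x_2\<close>, and \<open>\<nu>\<close> cancels the coefficient
    \<open>\<mu>\<close>.\<close>
  also have "E - var3 1 ^ (k + 2) = \<mu> * var3 0 ^ (k + 1) * var3 2"
    by (simp add: E_def)
  also have "\<nu> * (\<nu> ^ (k + 2) * var3 0 ^ (k + 2) * E ^ (k + 2) * var3 1 * (\<mu> * var3 0 ^ (k + 1) * var3 2))
      = \<nu> * (\<mu> * (\<nu> ^ (k + 2) * var3 0 ^ (k + 2) * E ^ (k + 2) * var3 1 * (var3 0 ^ (k + 1) * var3 2)))"
    by (simp only: mult_ac)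
  finally show ?case
    by (simp only: mult_cancel) (simp only: mult_ac)
qed (simp_all add: curve_inverse_def polar_map_def partials_curve_form subst3_ring
    power_mult_distrib mult_ac)

text \<open>Up to a common factor, the power of \<open>x_1\<close> in \<open>E\<close> contributes
  exactly the monomial that is subtracted in the last component of the inverse, so a single monomial
  survives.\<close>

lemma subst3_E_curve_inverse:
  "subst3 E curve_inverse = var3 0 * var3 2 ^ (k + 1) * var3 1 ^ ((k + 2) * (k + 2))"
proof -
  let ?P = "var3 1 ^ ((k + 1) * (k + 2)) :: 'a poly3"
  let ?D = "var3 1 ^ (k + 2) * var3 0 - \<nu> ^ (k + 2) * var3 2 * var3 0 ^ (k + 2)"
  have "subst3 E curve_inverse = (\<nu> * var3 0 * var3 2 * var3 1 ^ (k + 1)) ^ (k + 2)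
      + \<mu> * (var3 2 * var3 1 ^ (k + 2)) ^ (k + 1) * (\<nu> * ?D)"
    by (simp add: E_def subst3_ring curve_inverse_def)
  also have "\<mu> * (var3 2 * var3 1 ^ (k + 2)) ^ (k + 1) * (\<nu> * ?D)
      = \<nu> * (\<mu> * ((var3 2 * var3 1 ^ (k + 2)) ^ (k + 1) * ?D))"
    by (simp only: mult_ac)
  also have "\<dots> = var3 2 ^ (k + 1) * ?P * ?D"
    by (simp only: mult_cancel power_mult_distrib mult.commute[of "k + 1" "k + 2"] power_mult)
  also have "(\<nu> * var3 0 * var3 2 * var3 1 ^ (k + 1)) ^ (k + 2)
      = var3 2 ^ (k + 1) * ?P * (\<nu> ^ (k + 2) * var3 2 * var3 0 ^ (k + 2))"
    by (simp only: power_mult_distrib power_mult) (simp add: mult_ac)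
  also have "\<dots> + var3 2 ^ (k + 1) * ?P * ?D = var3 2 ^ (k + 1) * ?P * (var3 1 ^ (k + 2) * var3 0)"
    by (simp only: flip: distrib_left) simp
  also have "\<dots> = var3 0 * var3 2 ^ (k + 1) * (?P * var3 1 ^ (k + 2))"
    by (simp only: mult_ac)
  also have "?P * var3 1 ^ (k + 2) = var3 1 ^ ((k + 2) * (k + 2))"
    by (simp add: algebra_simps flip: power_add)
  finally show ?thesis .
qed

text \<open>Since \<open>E\<close> becomes a monomial, so do all three partial derivatives, up to
  constants.\<close>

lemma polar_curve_inverse:
  "subst3 (polar_map curve_form i) curve_inverse
    = (\<nu> * var3 0 * var3 2 ^ (k + 2) * var3 1 ^ (k + 1) * var3 1 ^ ((k + 2) * (k + 2))) * var3 i"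
  unfolding polar_map_def
proof (induction i rule: three_cases)
  case 1
  show ?case
    unfolding partials_curve_form subst3_mult subst3_E_curve_inverse
    by (simp add: curve_inverse_def mult_ac)
next
  case 2
  show ?case
    unfolding partials_curve_form subst3_mult subst3_E_curve_inverse
    by (simp add: curve_inverse_def mult_ac)
next
  case 3
  have "subst3 (var3 0 ^ (k + 2) * var3 1) curve_inverse =
     var3 2 ^ (k + 2) * (var3 1 ^ (k + 2)) ^ (k + 2) * (\<nu> * var3 0 * var3 2 * var3 1 ^ (k + 1))"
    by (simp add: subst3_mult subst3_power curve_inverse_def power_mult_distrib)
  then show ?case
    unfolding partials_curve_form power_mult by (simp only: mult_ac)
qed

lemma birational_curve_form: "birational (polar_map curve_form)"
proof (rule birationalI[OF _ form_curve_inverse polar_curve_inverse _ curve_inverse_polar])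
  show "is_form (k + 3) (polar_map curve_form i)" for i
    unfolding polar_map_def by (rule is_form_partial[OF form_curve_form])
qed (simp_all add: \<mu>_\<nu>_nonzero E_nonzero)

lemma curve_form_nonzero: "curve_form \<noteq> 0"
proof
  assume "curve_form = 0"
  with partials_curve_form(3) show False by simp
qed

end

section \<open>The conditions on the characteristic\<close>

lemma homaloidal_curve_G:
  assumes "n \<ge> 2" "CHAR('a::alg_closed_field) dvd n * (n - 1) - 1"
  shows "homaloidal_curve (zero_locus
      (var3 0 * var3 1 * (var3 1 ^ (n - 1) + var3 0 ^ (n - 2) * var3 2) :: 'a poly3))"
proof -
  have "of_nat (n * (n - 1) - 1) = (0 :: 'a)"
    using assms(2) by (simp add: of_nat_eq_0_iff_char_dvd)
  moreover have "n * (n - 1) = Suc (n * (n - 1) - 1)"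
    using assms(1) by simp
  ultimately have eq: "of_nat (n * (n - 1)) = (1 :: 'a)"
    by (metis of_nat_Suc add.right_neutral)
  \<comment> \<open>For \<open>n = 2\<close> the characteristic would divide 1, but no field has
    characteristic 1.\<close>
  have "n \<noteq> 2"
    using assms(2) by auto
  then obtain k where n: "n = k + 3"
    using assms(1) by (metis add.commute le_Suc_ex le_antisym not_less_eq_eq numeral_2_eq_2 numeral_3_eq_3)
  have inv: "of_nat ((k + 3) * (k + 2)) = (1 :: 'a)"
    using eq unfolding n by simp
  have "homaloidal_curve (zero_locus (curve_form k :: 'a poly3))"
    by (rule homaloidal_curveI[OF form_curve_form[OF inv] curve_form_nonzero[OF inv]
          partials_curve_form_coprime[OF inv] birational_curve_form[OF inv]])
  then show ?thesis by (simp add: curve_form_def[OF inv] n)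
qed

theorem theorem2p4:
  fixes p :: nat
  assumes "CHAR('a::alg_closed_field) = p"
  shows "(\<forall>n\<ge>2. p dvd n \<longrightarrow>
            (\<forall>F :: ('a ^ 3) set set. near_pencil n F \<longrightarrow> homaloidal_curve F)) \<and>
         (\<forall>n\<ge>2. p dvd n * (n - 1) - 1 \<longrightarrow>
            homaloidal_curve (zero_locus
              (var3 0 * var3 1 * (var3 1 ^ (n - 1) + var3 0 ^ (n - 2) * var3 2) :: 'a poly3)))"
proof (intro conjI allI impI)
  fix n and F :: "('a ^ 3) set set"
  assume "2 \<le> n" "p dvd n" "near_pencil n F"
  then show "homaloidal_curve F"
    by (intro near_pencil_homaloidal_curve[of n F]) (simp_all add: of_nat_eq_0_iff_char_dvd assms)
next
  fix n :: nat assume "2 \<le> n" "p dvd n * (n - 1) - 1"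
  then show "homaloidal_curve (zero_locus
      (var3 0 * var3 1 * (var3 1 ^ (n - 1) + var3 0 ^ (n - 2) * var3 2) :: 'a poly3))"
    by (intro homaloidal_curve_G) (simp_all only: assms)
qed

end
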